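(* Let $p_{-1},p_1,p_{-1,1}$ be weights and let $D^+(x,y;t)=\sum_w\big(\prod_{s\in w}p_s\big)x^{\min^+(w)}y^{\max^+(w)}t^{|w|}$ over all Dyck N-meanders $w$. Let $$S(x,y)=\frac{p_{-1}}{xy}+p_1xy+p_{-1,1}\frac yx,\quad Y(t)=\frac{1-\sqrt{1-4p_{-1}(p_1+p_{-1,1})t^2}}{2(p_1+p_{-1,1})t},\quad X(y,t)=\frac{1-\sqrt{1-4p_1(p_{-1}+p_{-1,1}y^2)t^2}}{2p_1yt}.$$ Then $D^+(x,y;t)$ is algebraic of degree $4$ (and of degree $2$ if any $p_i=0$), and $$D^+(x,y;t)=\begin{cases}\dfrac{x-X(y,t)}{1-X(y,t)^2}\cdot\dfrac{y-xY(t)-X(y,t)Y(t)+xyX(y,t)}{xy(1-tS(x,y))}, & p_1>0,\\[3mm]\dfrac{y^2-xyY(t)+t(p_{-1,1}y^2+p_{-1})(Y(t)-xy)}{y^2-t^2(p_{-1,1}y^2+p_{-1})^2}, & p_1=0.\end{cases}$$ Moreover $D^+(1,y;t)$ and $D^+(0,0;t)$ are algebraic of degree $2$, and the generating function $D^+(0,1;t)$ of Dyck N-excursions is algebraic of degree $4$ (degree $2$ when $p_1=p_{-1}$).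
   Context: An N-step is a non-empty finite set of integers. Dyck N-walks are finite sequences $w=(s_1,\dots,s_n)$ of N-steps from $\{\{-1\},\{1\},\{-1,1\}\}$, starting at $0$, $|w|=n$; N-step $s$ has weight $p_s$ and a walk's weight is the product of its N-steps' weights. A classical walk $(v_1,\dots,v_n)$ with positions $\omega_k=\sum_{i\le k}v_i$ is compatible with $w$ if $v_i\in s_i$ for all $i$; it is a meander if all $\omega_k\ge0$ and an excursion if moreover $\omega_n=0$. An N-meander (resp. N-excursion) is an N-walk compatible with at least one meander (resp. excursion). The reachable points of an N-meander are the endpoints of all compatible meanders; $\min^+(w)$, $\max^+(w)$ are their minimum and maximum.
   Formalization: For p_1=0 the numerator's last term has sign minus (the printed plus is wrong at t^1) and p_{-1,1}>0 is required so Y is defined; weights are nonnegative reals; exact degrees are claimed only at non-degenerate weights, since e.g. with two zero weights the series is rational. *)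

theory Defs
  imports "HOL-Computational_Algebra.Computational_Algebra"
begin

section \<open>Nondeterministic Dyck walks\<close>

definition dyck_steps :: "int set set" where
  "dyck_steps = {{-1}, {1}, {-1, 1}}"

definition dyck_walks :: "nat \<Rightarrow> int set list set" where
  "dyck_walks n = {w. set w \<subseteq> dyck_steps \<and> length w = n}"

definition compatible :: "int list \<Rightarrow> int set list \<Rightarrow> bool" where
  "compatible v w \<longleftrightarrow> length v = length w \<and> (\<forall>i < length w. v ! i \<in> w ! i)"

definition meander :: "int list \<Rightarrow> bool" where
  "meander v \<longleftrightarrow> (\<forall>k \<le> length v. 0 \<le> sum_list (take k v))"

definition excursion :: "int list \<Rightarrow> bool" where
  "excursion v \<longleftrightarrow> meander v \<and> sum_list v = 0"

definition N_meander :: "int set list \<Rightarrow> bool" where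
  "N_meander w \<longleftrightarrow> (\<exists>v. compatible v w \<and> meander v)"

definition N_excursion :: "int set list \<Rightarrow> bool" where
  "N_excursion w \<longleftrightarrow> (\<exists>v. compatible v w \<and> excursion v)"

definition reachable :: "int set list \<Rightarrow> int set" where
  "reachable w = {sum_list v | v. compatible v w \<and> meander v}"

definition min_plus :: "int set list \<Rightarrow> int" where
  "min_plus w = Min (reachable w)"

definition max_plus :: "int set list \<Rightarrow> int" where
  "max_plus w = Max (reachable w)"

definition walk_weight :: "(int set \<Rightarrow> 'a::comm_ring_1) \<Rightarrow> int set list \<Rightarrow> 'a" where
  "walk_weight p w = prod_list (map p w)"

text \<open>
  The series variable is \<open>t\<close>. The remaining variables \<open>x\<close>, \<open>y\<close> are elements of the
  coefficient ring: the indeterminates of \<open>\<real>(x,y)\<close> give the full series, other elements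
  give its specialisations. For an N-meander the exponents are nonnegative, so \<open>nat\<close>
  loses nothing, and \<open>0 ^ 0 = 1\<close> makes the substitution of \<open>0\<close> the usual one.
\<close>

definition D_plus :: "(int set \<Rightarrow> 'a) \<Rightarrow> 'a \<Rightarrow> 'a \<Rightarrow> 'a::comm_ring_1 fps" where
  "D_plus p x y = Abs_fps (\<lambda>n. \<Sum>w \<in> {w \<in> dyck_walks n. N_meander w}.
     walk_weight p w * x ^ nat (min_plus w) * y ^ nat (max_plus w))"

definition excursion_gf :: "(int set \<Rightarrow> 'a) \<Rightarrow> 'a::comm_ring_1 fps" where
  "excursion_gf p = Abs_fps (\<lambda>n. \<Sum>w \<in> {w \<in> dyck_walks n. N_excursion w}. walk_weight p w)"


section \<open>The auxiliary functions of the closed form\<close>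

definition step_poly :: "(int set \<Rightarrow> 'a) \<Rightarrow> 'a \<Rightarrow> 'a \<Rightarrow> 'a::field" where
  "step_poly p x y = p {-1} / (x * y) + p {1} * x * y + p {-1, 1} * (y / x)"

text \<open>The square root, with constant term \<open>1\<close>, of a power series with constant term \<open>1\<close>.\<close>

definition sqrt1 :: "'a::field_char_0 fps \<Rightarrow> 'a fps" where
  "sqrt1 f = fps_radical (\<lambda>_ _. 1) 2 f"

text \<open>
  In both quotients below the numerator is divisible by \<open>fps_X ^ 2\<close>, so division of formal
  power series is exact whenever the scalar in the denominator is nonzero.
\<close>

definition Y_fun :: "(int set \<Rightarrow> 'a) \<Rightarrow> 'a::field_char_0 fps" where
  "Y_fun p = (1 - sqrt1 (1 - fps_const (4 * p {-1} * (p {1} + p {-1, 1})) * fps_X ^ 2))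
     / (fps_const (2 * (p {1} + p {-1, 1})) * fps_X)"

definition X_fun :: "(int set \<Rightarrow> 'a) \<Rightarrow> 'a \<Rightarrow> 'a::field_char_0 fps" where
  "X_fun p y = (1 - sqrt1 (1 - fps_const (4 * p {1} * (p {-1} + p {-1, 1} * y ^ 2)) * fps_X ^ 2))
     / (fps_const (2 * p {1} * y) * fps_X)"


section \<open>Algebraic power series\<close>

text \<open>
  For \<open>F\<close> the coefficient field, algebraicity and degree are taken over \<open>F(t)\<close>; denominators
  are cleared, so that polynomial relations have coefficients in \<open>F[t]\<close>. For the coefficient
  fields \<open>\<real>(x,y)\<close>, \<open>\<real>(y)\<close>, \<open>\<real>\<close> this is algebraicity over \<open>\<real>(x,y,t)\<close>, \<open>\<real>(y,t)\<close>, \<open>\<real>(t)\<close>.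
\<close>

definition annihilates :: "'a::field poly poly \<Rightarrow> 'a fps \<Rightarrow> bool" where
  "annihilates P f \<longleftrightarrow> P \<noteq> 0 \<and> poly (map_poly fps_of_poly P) f = 0"

definition algebraic_fps :: "'a::field fps \<Rightarrow> bool" where
  "algebraic_fps f \<longleftrightarrow> (\<exists>P. annihilates P f)"

definition algebraic_degree :: "'a::field fps \<Rightarrow> nat" where
  "algebraic_degree f = (LEAST d. \<exists>P. annihilates P f \<and> degree P = d)"


section \<open>Rational function fields\<close>

text \<open>
  \<open>real poly fract\<close> is \<open>\<real>(y)\<close>. In \<open>real poly poly fract = \<real>(x,y)\<close> the outer polynomial
  variable is \<open>x\<close> and the inner one is \<open>y\<close>.
\<close>

definition const1 :: "real \<Rightarrow> real poly fract" where
  "const1 c = to_fract [:c:]"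

definition var1_y :: "real poly fract" where
  "var1_y = to_fract [:0, 1:]"

definition const2 :: "real \<Rightarrow> real poly poly fract" where
  "const2 c = to_fract [:[:c:]:]"

definition var2_x :: "real poly poly fract" where
  "var2_x = to_fract [:0, 1:]"

definition var2_y :: "real poly poly fract" where
  "var2_y = to_fract [:[:0, 1:]:]"

end

theory Submission
  imports Defs
begin

text \<open>
  The reachable points of an N-meander form an arithmetic progression of difference 2, so a walk
  matters only through \<open>min\<^sup>+\<close> and \<open>max\<^sup>+\<close>, and appending a step gives a functional
  equation for \<open>D\<^sup>+\<close> with unknowns \<open>D\<^sup>+(0,y)\<close> and \<open>D\<^sup>+(0,0)\<close>. The kernel method
  determines both: the kernel vanishes at \<open>x = X(y,t)\<close>, and for \<open>x = 1\<close> at \<open>y = Y(t)\<close>.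

  Up to rational factors \<open>X\<close> and \<open>Y\<close> are \<open>1 - U\<close> and \<open>1 - V\<close> with
  \<open>U\<^sup>2 = 1 - \<alpha> t\<^sup>2\<close> and \<open>V\<^sup>2 = 1 - \<beta> t\<^sup>2\<close>, and clearing denominators gives
  \<open>d D\<^sup>+ = A + B U + C V + D U V\<close> with polynomials \<open>d, A, B, C, D\<close> in \<open>t\<close>. If \<open>\<alpha>\<close>, \<open>\<beta>\<close> and
  \<open>\<alpha> - \<beta>\<close> are nonzero, then \<open>1, U, V, U V\<close> are linearly independent over the polynomials, every
  annihilating polynomial also kills the conjugates obtained by changing the signs of \<open>U\<close> and \<open>V\<close>,
  and these are four different series when \<open>C\<close> and \<open>D\<close> are nonzero. In the degenerate cases one of the two
  square roots disappears or they coincide.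
\<close>

section \<open>Reachable points and the functional equation\<close>

text \<open>For \<open>M < m\<close> the set is empty. This is how a walk that stops being an
  N-meander fits into the same formulas.\<close>

definition progression2 :: "int \<Rightarrow> int \<Rightarrow> int set" where
  "progression2 m M = {k. m \<le> k \<and> k \<le> M \<and> even (k - m)}"

lemma Min_progression2: "0 \<le> m \<Longrightarrow> m \<le> M \<Longrightarrow> Min (progression2 m M) = m"
  by (rule Min_eqI) (auto simp: progression2_def intro: finite_subset[of _ "{m..M}"])

lemma Max_progression2:
  "0 \<le> m \<Longrightarrow> m \<le> M \<Longrightarrow> even (M - m) \<Longrightarrow> Max (progression2 m M) = M"
  by (rule Max_eqI) (simp_all add: progression2_def finite_subset[of _ "{m..M}"] subset_iff)

lemma compatible_snoc:
  "compatible v (w @ [s]) \<longleftrightarrow> (\<exists>v' r. v = v' @ [r] \<and> compatible v' w \<and> r \<in> s)"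
proof
  assume c: "compatible v (w @ [s])"
  then have "v \<noteq> []" by (auto simp: compatible_def)
  then obtain v' r where v: "v = v' @ [r]" by (metis rev_exhaust)
  with c have len: "length v' = length w" by (auto simp: compatible_def)
  have all: "v ! i \<in> (w @ [s]) ! i" if "i < Suc (length w)" for i
    using c that by (auto simp: compatible_def)
  have "v' ! i \<in> w ! i" if "i < length w" for i
    using all[of i] that by (simp add: v nth_append len)
  moreover have "r \<in> s"
    using all[of "length w"] by (simp add: v nth_append len)
  ultimately show "\<exists>v' r. v = v' @ [r] \<and> compatible v' w \<and> r \<in> s"
    using v len by (auto simp: compatible_def)
next
  assume "\<exists>v' r. v = v' @ [r] \<and> compatible v' w \<and> r \<in> s"
  then show "compatible v (w @ [s])"
    by (auto simp: compatible_def nth_append less_Suc_eq)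
qed

lemma meander_snoc: "meander (v @ [r]) \<longleftrightarrow> meander v \<and> 0 \<le> sum_list v + r"
  by (auto simp: meander_def le_Suc_eq)

text \<open>Every prefix of a meander is a meander, so only the final position has to be tested and
  the reachable set evolves step by step, without memory of the individual paths.\<close>

lemma reachable_snoc:
  "reachable (w @ [s]) = {k + r | k r. k \<in> reachable w \<and> r \<in> s \<and> 0 \<le> k + r}"
  unfolding reachable_def
  by (auto simp: compatible_snoc meander_snoc)
    (metis meander_snoc sum_list.append sum_list_simps(1) sum_list.Cons add_0_right)+

lemma reachable_Nil: "reachable [] = {0}"
  by (auto simp: reachable_def compatible_def meander_def)

lemma N_meander_iff: "N_meander w \<longleftrightarrow> reachable w \<noteq> {}"
  by (auto simp: N_meander_def reachable_def)

text \<open>A descent from altitude 0 is lost, so for \<open>m = 0\<close> the smallest point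
  reached by descending comes from 2, or by ascending from 0; in both cases the new lower end is 1.
  For \<open>m = M = 0\<close> the step \<open>{-1}\<close> yields
  \<open>progression2 1 (-1)\<close>, the empty set.\<close>

lemma reachable_snoc_cases:
  assumes "reachable w = progression2 m M" "0 \<le> m" "m \<le> M" "even (M - m)"
  shows "reachable (w @ [{-1}]) = progression2 (if m = 0 then 1 else m - 1) (M - 1)"
    and "reachable (w @ [{1}]) = progression2 (m + 1) (M + 1)"
    and "reachable (w @ [{-1, 1}]) = progression2 (if m = 0 then 1 else m - 1) (M + 1)"
proof -
  define m' where "m' = (if m = 0 then 1 else m - 1)"
  \<comment> \<open>The third fact excludes the single integer \<open>k = m\<close> on which the
    inequalities alone disagree: the altitude 0 when \<open>m = 0\<close>, and the gap between the
    two shifted progressions when \<open>m = M\<close>.\<close>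
  have parity: "even (k + 1 - m) \<longleftrightarrow> even (k - m')" "even (k - 1 - m) \<longleftrightarrow> even (k - m')"
    "even (k - m') \<Longrightarrow> k \<noteq> m" for k
    by (auto simp: m'_def split: if_splits)
  have m': "m' = 1 \<and> m = 0 \<or> m' = m - 1 \<and> 1 \<le> m" using assms(2) by (auto simp: m'_def)
  have down: "k + 1 \<in> progression2 m M \<and> 0 \<le> k \<longleftrightarrow> k \<in> progression2 m' (M - 1)" for k
    unfolding progression2_def mem_Collect_eq parity using parity(3)[of k] m' by linarith
  have up: "k - 1 \<in> progression2 m M \<longleftrightarrow> k \<in> progression2 (m + 1) (M + 1)" for k
    by (auto simp: progression2_def algebra_simps)
  have fork: "(k - 1 \<in> progression2 m M \<or> k + 1 \<in> progression2 m M) \<and> 0 \<le> k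
      \<longleftrightarrow> k \<in> progression2 m' (M + 1)" for k
    unfolding progression2_def mem_Collect_eq parity
    using parity(3)[of k] m' assms(3) by linarith
  have nonneg: "0 \<le> k" if "k \<in> progression2 (m + 1) (M + 1)" for k
    using that assms(2) by (auto simp: progression2_def)
  have "k \<in> reachable (w @ [{-1}]) \<longleftrightarrow> k + 1 \<in> progression2 m M \<and> 0 \<le> k" for k
    unfolding reachable_snoc assms(1) by force
  then show "reachable (w @ [{-1}]) = progression2 (if m = 0 then 1 else m - 1) (M - 1)"
    unfolding down m'_def by blast
  have "k \<in> reachable (w @ [{1}]) \<longleftrightarrow> k - 1 \<in> progression2 m M \<and> 0 \<le> k" for k
    unfolding reachable_snoc assms(1) by force
  then show "reachable (w @ [{1}]) = progression2 (m + 1) (M + 1)"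
    unfolding up using nonneg by blast
  have "k \<in> reachable (w @ [{-1, 1}])
      \<longleftrightarrow> (k - 1 \<in> progression2 m M \<or> k + 1 \<in> progression2 m M) \<and> 0 \<le> k" for k
    unfolding reachable_snoc assms(1) by force
  then show "reachable (w @ [{-1, 1}]) = progression2 (if m = 0 then 1 else m - 1) (M + 1)"
    unfolding fork m'_def by blast
qed

lemma reachable_progression2:
  assumes "set w \<subseteq> dyck_steps" "N_meander w"
  shows "\<exists>m M. 0 \<le> m \<and> m \<le> M \<and> even (M - m) \<and> reachable w = progression2 m M"
  using assms
proof (induction w rule: rev_induct)
  case Nil
  have "reachable [] = progression2 0 0" by (auto simp: reachable_Nil progression2_def)
  then show ?case by (metis order_refl diff_self even_zero)
next
  case (snoc s w)
  then have "N_meander w" by (auto simp: N_meander_iff reachable_snoc)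
  with snoc obtain m M where mM: "0 \<le> m" "m \<le> M" "even (M - m)" "reachable w = progression2 m M"
    by auto
  note r = reachable_snoc_cases[OF mM(4,1,2,3)]
  let ?m = "if m = 0 then 1 else m - 1"
  have ev: "even (M - 1 - ?m)" "even (M + 1 - ?m)" "even (M + 1 - (m + 1))" "?m \<le> M + 1" "0 \<le> ?m"
    using mM by auto
  from snoc.prems(1) consider "s = {-1}" | "s = {1}" | "s = {-1, 1}"
    by (auto simp: dyck_steps_def)
  then show ?case
  proof cases
    case 1
    \<comment> \<open>Only a forced descent can leave no reachable point; the assumption that the
      extended walk is an N-meander rules this out.\<close>
    have "progression2 ?m (M - 1) \<noteq> {}"
      using snoc.prems(2) unfolding 1 N_meander_iff r .
    then have "?m \<le> M - 1" unfolding progression2_def by fastforce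
    then show ?thesis unfolding 1 r(1) using ev by blast
  next
    case 2
    show ?thesis unfolding 2 r(2) using ev mM by (metis add_mono order_refl zero_le_one add_nonneg_nonneg)
  next
    case 3
    show ?thesis unfolding 3 r(3) using ev by blast
  qed
qed

section \<open>Contribution of a single walk and the functional equation\<close>

text \<open>Extending the contribution by 0 to walks that are not N-meanders lets each coefficient
  be a sum over all Dyck N-walks, to which steps can be appended freely.\<close>

definition walk_term :: "(int set \<Rightarrow> 'a) \<Rightarrow> 'a \<Rightarrow> 'a \<Rightarrow> int set list \<Rightarrow> 'a::comm_ring_1" where
  "walk_term p x y w =
    (if N_meander w then walk_weight p w * x ^ nat (min_plus w) * y ^ nat (max_plus w) else 0)"

lemma finite_dyck_walks: "finite (dyck_walks n)"
  unfolding dyck_walks_def by (rule finite_lists_length_eq) (simp add: dyck_steps_def)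

lemma D_plus_nth: "D_plus p x y $ n = (\<Sum>w\<in>dyck_walks n. walk_term p x y w)"
  unfolding D_plus_def walk_term_def
  by (simp add: finite_dyck_walks sum.If_cases Int_def)

lemma dyck_walks_Suc:
  "dyck_walks (Suc n) = (\<lambda>(w, s). w @ [s]) ` (dyck_walks n \<times> dyck_steps)"
proof (intro set_eqI iffI)
  fix w assume w: "w \<in> dyck_walks (Suc n)"
  then have "w \<noteq> []" by (auto simp: dyck_walks_def)
  then obtain w' s where "w = w' @ [s]" by (metis rev_exhaust)
  with w show "w \<in> (\<lambda>(w, s). w @ [s]) ` (dyck_walks n \<times> dyck_steps)"
    by (auto simp: dyck_walks_def intro!: image_eqI[of _ _ "(w', s)"])
qed (auto simp: dyck_walks_def)

lemma sum_dyck_steps: "(\<Sum>s\<in>dyck_steps. f s) = f {-1} + f {1} + (f {-1, 1} :: 'a::comm_monoid_add)"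
proof -
  have "{1} \<noteq> {-1, 1 :: int}" "{-1} \<noteq> {-1, 1 :: int}" by auto
  then show ?thesis by (simp add: dyck_steps_def add.assoc)
qed

lemma D_plus_nth_0: "D_plus p x y $ 0 = 1"
proof -
  have "dyck_walks 0 = {[]}" by (auto simp: dyck_walks_def)
  then show ?thesis
    by (simp add: D_plus_nth walk_term_def N_meander_iff reachable_Nil min_plus_def max_plus_def
        walk_weight_def)
qed

lemma D_plus_nth_Suc:
  "D_plus p x y $ Suc n = (\<Sum>w\<in>dyck_walks n. walk_term p x y (w @ [{-1}])
     + walk_term p x y (w @ [{1}]) + walk_term p x y (w @ [{-1, 1}]))"
proof -
  have "D_plus p x y $ Suc n = (\<Sum>(w, s)\<in>dyck_walks n \<times> dyck_steps. walk_term p x y (w @ [s]))"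
    unfolding D_plus_nth dyck_walks_Suc
    by (subst sum.reindex) (auto simp: inj_on_def o_def case_prod_unfold)
  then show ?thesis by (simp add: sum.cartesian_product[symmetric] sum_dyck_steps)
qed

lemma walk_term_not_meander: "\<not> N_meander w \<Longrightarrow> walk_term p x y (w @ [s]) = 0"
  by (auto simp: walk_term_def N_meander_iff reachable_snoc)

lemma walk_term_progression2:
  assumes "reachable w = progression2 m M" "0 \<le> m" "even (M - m)"
  shows "walk_term p x y w = (if m \<le> M then walk_weight p w * x ^ nat m * y ^ nat M else 0)"
proof (cases "m \<le> M")
  case True
  then have "m \<in> reachable w" using assms by (auto simp: progression2_def)
  then show ?thesis
    using assms True
    by (auto simp: walk_term_def N_meander_iff min_plus_def max_plus_def Min_progression2 Max_progression2)
next
  case False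
  then have "reachable w = {}" using assms by (auto simp: progression2_def)
  then show ?thesis using False by (simp add: walk_term_def N_meander_iff)
qed

lemma walk_term_snoc:
  assumes w: "reachable w = progression2 m M" "0 \<le> m" "m \<le> M" "even (M - m)"
  shows "walk_term p x y (w @ [{-1}])
           = (if m = 0 then if M = 0 then 0 else walk_weight p w * p {-1} * x * y ^ nat (M - 1)
              else walk_weight p w * p {-1} * x ^ nat (m - 1) * y ^ nat (M - 1))"
    and "walk_term p x y (w @ [{1}]) = walk_weight p w * p {1} * x ^ nat (m + 1) * y ^ nat (M + 1)"
    and "walk_term p x y (w @ [{-1, 1}])
           = walk_weight p w * p {-1, 1} * x ^ (if m = 0 then 1 else nat (m - 1)) * y ^ nat (M + 1)"
proof -
  note r = reachable_snoc_cases[OF w]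
  \<comment> \<open>\<open>M\<close> is even when \<open>m = 0\<close>, so the condition
    \<open>1 \<le> M - 1\<close> for surviving a descent amounts to
    \<open>M \<noteq> 0\<close>.\<close>
  have M: "M \<noteq> 1" if "m = 0" using w(4) that by auto
  have "walk_term p x y (w @ [{-1}])
      = (if (if m = 0 then 1 else m - 1) \<le> M - 1
         then walk_weight p (w @ [{-1}]) * x ^ nat (if m = 0 then 1 else m - 1) * y ^ nat (M - 1) else 0)"
    by (rule walk_term_progression2[OF r(1)]) (use w in auto)
  then show "walk_term p x y (w @ [{-1}])
           = (if m = 0 then if M = 0 then 0 else walk_weight p w * p {-1} * x * y ^ nat (M - 1)
              else walk_weight p w * p {-1} * x ^ nat (m - 1) * y ^ nat (M - 1))"
    using w(2,3) M by (auto simp: walk_weight_def)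
  have "walk_term p x y (w @ [{1}])
      = (if m + 1 \<le> M + 1 then walk_weight p (w @ [{1}]) * x ^ nat (m + 1) * y ^ nat (M + 1) else 0)"
    by (rule walk_term_progression2[OF r(2)]) (use w in auto)
  then show "walk_term p x y (w @ [{1}]) = walk_weight p w * p {1} * x ^ nat (m + 1) * y ^ nat (M + 1)"
    using w(3) by (simp add: walk_weight_def)
  have "walk_term p x y (w @ [{-1, 1}])
      = (if (if m = 0 then 1 else m - 1) \<le> M + 1
         then walk_weight p (w @ [{-1, 1}]) * x ^ nat (if m = 0 then 1 else m - 1) * y ^ nat (M + 1) else 0)"
    by (rule walk_term_progression2[OF r(3)]) (use w in auto)
  then show "walk_term p x y (w @ [{-1, 1}])
           = walk_weight p w * p {-1, 1} * x ^ (if m = 0 then 1 else nat (m - 1)) * y ^ nat (M + 1)"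
    using w(2,3) by (auto simp: walk_weight_def)
qed

text \<open>Away from the boundary, appending a step multiplies the contribution by the step
  polynomial. If \<open>m = 0\<close>, the exponent -1 of x must become 1 for the two descending
  choices; multiplied by \<open>x * y\<close> this correction carries the factor
  \<open>x^2 - 1\<close>, and \<open>walk_term p 0 y\<close> selects these walks because
  \<open>0 ^ 0 = 1\<close>. If also \<open>M = 0\<close>, the step \<open>{-1}\<close> kills the
  walk, which the last term subtracts.\<close>

lemma walk_term_rec:
  fixes p :: "int set \<Rightarrow> 'a::comm_ring_1"
  assumes "set w \<subseteq> dyck_steps"
  shows "x * y * (walk_term p x y (w @ [{-1}]) + walk_term p x y (w @ [{1}])
           + walk_term p x y (w @ [{-1, 1}]))
         = (p {-1} + p {1} * x^2 * y^2 + p {-1, 1} * y^2) * walk_term p x y w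
           + (x^2 - 1) * (p {-1} + p {-1, 1} * y^2) * walk_term p 0 y w
           - p {-1} * x^2 * walk_term p 0 0 w"
proof (cases "N_meander w")
  case False
  then show ?thesis by (simp add: walk_term_not_meander) (simp add: walk_term_def)
next
  case True
  from reachable_progression2[OF assms True] obtain m M
    where w: "reachable w = progression2 m M" "0 \<le> m" "m \<le> M" "even (M - m)" by blast
  obtain i j where ij: "m = int i" "M = int j" using w(2,3) by (meson order_trans zero_le_imp_eq_int)
  have s: "nat (int k + 1) = Suc k" "nat (1 + int k) = Suc k" "nat (2 + int k) = Suc (Suc k)"
    "nat (int k + 2) = Suc (Suc k)" "nat (int k - 1) = k - 1" for k by auto
  note t = walk_term_snoc[OF w, of p x y] walk_term_progression2[OF w(1,2,4)]
  show ?thesis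
    unfolding t using w(3) unfolding ij
    by (cases i; cases j; simp add: s algebra_simps power2_eq_square)
qed

text \<open>Summation of \<open>walk_term_rec\<close> over all walks of a given length. It holds
  over every commutative ring, which later allows power series to take the place of \<open>x\<close>
  and \<open>y\<close>.\<close>

lemma D_plus_functional_equation:
  fixes p :: "int set \<Rightarrow> 'a::comm_ring_1"
  shows "fps_const (x * y) * (D_plus p x y - 1)
     = fps_X * (fps_const (p {-1} + p {1} * x^2 * y^2 + p {-1, 1} * y^2) * D_plus p x y
         + fps_const ((x^2 - 1) * (p {-1} + p {-1, 1} * y^2)) * D_plus p 0 y
         - fps_const (p {-1} * x^2) * D_plus p 0 0)" (is "?l = ?r")
proof (rule fps_ext)
  fix n show "?l $ n = ?r $ n"
  proof (cases n)
    case 0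
    then show ?thesis by (simp add: D_plus_nth_0)
  next
    case (Suc k)
    have "?l $ n = (\<Sum>w\<in>dyck_walks k. x * y * (walk_term p x y (w @ [{-1}])
       + walk_term p x y (w @ [{1}]) + walk_term p x y (w @ [{-1, 1}])))"
      by (simp add: Suc D_plus_nth_Suc sum_distrib_left)
    also have "\<dots> = (\<Sum>w\<in>dyck_walks k.
        (p {-1} + p {1} * x^2 * y^2 + p {-1, 1} * y^2) * walk_term p x y w
           + (x^2 - 1) * (p {-1} + p {-1, 1} * y^2) * walk_term p 0 y w
           - p {-1} * x^2 * walk_term p 0 0 w)"
      by (intro sum.cong refl walk_term_rec) (auto simp: dyck_walks_def)
    also have "\<dots> = ?r $ n"
      by (simp add: Suc D_plus_nth sum.distrib sum_subtractf sum_distrib_left mult.assoc)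
    finally show ?thesis .
  qed
qed

text \<open>Both remaining steps raise the maximum above 0, so only the empty walk counts. This
  covers the case in which the kernel relation for \<open>D_plus p 0 0\<close> degenerates to
  \<open>0 = 0\<close>.\<close>

lemma D_plus_0_0_eq_1:
  fixes p :: "int set \<Rightarrow> 'a::comm_ring_1"
  assumes "p {-1} = 0"
  shows "D_plus p 0 0 = 1"
proof (rule fps_ext)
  fix n
  show "D_plus p 0 0 $ n = 1 $ n"
  proof (cases n)
    case (Suc k)
    have "walk_term p 0 0 (w @ [{-1}]) + walk_term p 0 0 (w @ [{1}])
      + walk_term p 0 0 (w @ [{-1, 1}]) = 0" if "w \<in> dyck_walks k" for w
    proof (cases "N_meander w")
      case True
      with that reachable_progression2[of w] obtain m M
        where w: "reachable w = progression2 m M" "0 \<le> m" "m \<le> M" "even (M - m)"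
        by (auto simp: dyck_walks_def)
      have "nat (M + 1) = Suc (nat M)" using w by auto
      then show ?thesis unfolding walk_term_snoc[OF w] by (simp add: assms)
    qed (simp add: walk_term_not_meander)
    then show ?thesis by (simp add: Suc D_plus_nth_Suc)
  qed (simp add: D_plus_nth_0)
qed

text \<open>The step \<open>{1}\<close> makes the minimum positive, so only the empty walk counts.
  In this case the coefficient of \<open>D_plus p 0 y\<close> in the functional equation
  vanishes.\<close>

lemma D_plus_0_eq_1:
  fixes p :: "int set \<Rightarrow> 'a::comm_ring_1"
  assumes "p {-1} = 0" "p {-1, 1} = 0"
  shows "D_plus p 0 y = 1"
proof (rule fps_ext)
  fix n
  show "D_plus p 0 y $ n = 1 $ n"
  proof (cases n)
    case (Suc k)
    have "walk_term p 0 y (w @ [{-1}]) + walk_term p 0 y (w @ [{1}])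
      + walk_term p 0 y (w @ [{-1, 1}]) = 0" if "w \<in> dyck_walks k" for w
    proof (cases "N_meander w")
      case True
      with that reachable_progression2[of w] obtain m M
        where w: "reachable w = progression2 m M" "0 \<le> m" "m \<le> M" "even (M - m)"
        by (auto simp: dyck_walks_def)
      have "nat (m + 1) = Suc (nat m)" using w by auto
      then show ?thesis unfolding walk_term_snoc[OF w] by (simp add: assms)
    qed (simp add: walk_term_not_meander)
    then show ?thesis by (simp add: Suc D_plus_nth_Suc)
  qed (simp add: D_plus_nth_0)
qed

text \<open>Setting \<open>y = 1\<close> forgets the maximum, and \<open>x = 0\<close> keeps the
  walks of minimum 0, which are those that can reach 0.\<close>

lemma D_plus_0_1: "D_plus p 0 1 = excursion_gf p"
proof (rule fps_ext)
  fix n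
  have "walk_term p 0 1 w = (if N_excursion w then walk_weight p w else 0)"
    if "w \<in> dyck_walks n" for w
  proof (cases "N_meander w")
    case True
    with that reachable_progression2[of w] obtain m M
      where w: "reachable w = progression2 m M" "0 \<le> m" "m \<le> M" "even (M - m)"
      by (auto simp: dyck_walks_def)
    have "N_excursion w \<longleftrightarrow> 0 \<in> reachable w"
      by (auto simp: N_excursion_def excursion_def reachable_def)
    also have "\<dots> \<longleftrightarrow> m = 0" using w by (auto simp: progression2_def)
    finally show ?thesis using w by (simp add: walk_term_progression2[OF w(1,2,4)] power_0_left)
  next
    case False
    then show ?thesis by (auto simp: walk_term_def N_excursion_def N_meander_def excursion_def)
  qed
  then show "D_plus p 0 1 $ n = excursion_gf p $ n"
    by (simp add: D_plus_nth excursion_gf_def finite_dyck_walks sum.If_cases Int_def)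
qed

section \<open>The kernel method\<close>

text \<open>Substituting a power series \<open>X\<close> for the coefficient \<open>x\<close> in \<open>D_plus p x y\<close> means taking \<open>D_plus\<close>
  over the coefficient ring of power series and then identifying the two series variables.\<close>

definition collapse :: "'a::comm_ring_1 fps fps \<Rightarrow> 'a fps" where
  "collapse F = Abs_fps (\<lambda>n. \<Sum>i\<le>n. F $ i $ (n - i))"

lemma collapse_add: "collapse (F + G) = collapse F + collapse G"
  and collapse_diff: "collapse (F - G) = collapse F - collapse G"
  and collapse_1: "collapse 1 = 1"
  by (auto simp: collapse_def fps_eq_iff sum.distrib sum_subtractf sum.atMost_shift)

lemma collapse_fps_X: "collapse (fps_X * F) = fps_X * collapse F"
proof (rule fps_ext)
  fix n show "collapse (fps_X * F) $ n = (fps_X * collapse F) $ n"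
    by (cases n) (auto simp: collapse_def sum.atMost_Suc_shift simp del: sum.atMost_Suc)
qed

text \<open>A constant of the outer ring is a series \<open>G\<close> in the inner variable; after
  identifying the variables it acts by ordinary multiplication. The proof exchanges the sums over
  \<open>i + j \<le> n\<close>.\<close>

lemma collapse_const: "collapse (fps_const G * F) = G * collapse F"
proof (rule fps_ext)
  fix n
  have "collapse (fps_const G * F) $ n
      = (\<Sum>i\<le>n. \<Sum>j\<le>n - i. G $ j * F $ i $ (n - i - j))"
    by (simp add: collapse_def) (simp add: fps_mult_nth atLeast0AtMost)
  also have "\<dots> = (\<Sum>(i, j)\<in>(SIGMA i:{..n}. {..n - i}). G $ j * F $ i $ (n - i - j))"
    by (simp add: sum.Sigma)
  also have "\<dots> = (\<Sum>(j, i)\<in>(SIGMA j:{..n}. {..n - j}). G $ j * F $ i $ (n - j - i))"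
    by (rule sum.reindex_bij_witness[where i = "\<lambda>(j, i). (i, j)" and j = "\<lambda>(i, j). (j, i)"])
      (auto simp: add.commute)
  also have "\<dots> = (G * collapse F) $ n"
    by (simp add: collapse_def fps_mult_nth atLeast0AtMost sum.Sigma sum_distrib_left)
  finally show "collapse (fps_const G * F) $ n = (G * collapse F) $ n" .
qed

lemma D_plus_const_nth:
  fixes p :: "int set \<Rightarrow> 'a::comm_ring_1"
  shows "D_plus (\<lambda>s. fps_const (p s)) (fps_const x) (fps_const y) $ n = fps_const (D_plus p x y $ n)"
proof -
  have "walk_weight (\<lambda>s. fps_const (p s)) w = fps_const (walk_weight p w)" for w
    by (induction w) (auto simp: walk_weight_def)
  then have "walk_term (\<lambda>s. fps_const (p s)) (fps_const x) (fps_const y) w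
      = fps_const (walk_term p x y w)" for w
    by (simp add: walk_term_def fps_const_power)
  moreover have "(\<Sum>w\<in>A. fps_const (f w)) = fps_const (\<Sum>w\<in>A. f w :: 'a)" for f and A :: "int set list set"
    by (induction A rule: infinite_finite_induct) auto
  ultimately show ?thesis by (simp add: D_plus_nth)
qed

text \<open>With constant entries the inner variable does not occur, so identifying the variables
  returns the original series.\<close>

lemma collapse_D_plus_const:
  fixes p :: "int set \<Rightarrow> 'a::comm_ring_1"
  shows "collapse (D_plus (\<lambda>s. fps_const (p s)) (fps_const x) (fps_const y)) = D_plus p x y"
proof (rule fps_ext)
  fix n
  have "collapse (D_plus (\<lambda>s. fps_const (p s)) (fps_const x) (fps_const y)) $ n
      = (\<Sum>i\<le>n. if i = n then D_plus p x y $ i else 0)"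
    unfolding collapse_def D_plus_const_nth by (auto intro!: sum.cong)
  then show "collapse (D_plus (\<lambda>s. fps_const (p s)) (fps_const x) (fps_const y)) $ n = D_plus p x y $ n"
    by simp
qed

lemma collapse_D_plus_const_0:
  fixes p :: "int set \<Rightarrow> 'a::comm_ring_1"
  shows "collapse (D_plus (\<lambda>s. fps_const (p s)) 0 (fps_const y)) = D_plus p 0 y"
    and "collapse (D_plus (\<lambda>s. fps_const (p s)) 0 0) = D_plus p 0 0"
  using collapse_D_plus_const[of p 0 y] collapse_D_plus_const[of p 0 0] by simp_all

lemma collapse_functional_equation:
  fixes p :: "int set \<Rightarrow> 'a::comm_ring_1" and X Y :: "'a fps"
  defines "q \<equiv> \<lambda>s. fps_const (p s)"
  shows "X * Y * (collapse (D_plus q X Y) - 1)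
     = fps_X * ((q {-1} + q {1} * X^2 * Y^2 + q {-1, 1} * Y^2) * collapse (D_plus q X Y)
         + (X^2 - 1) * (q {-1} + q {-1, 1} * Y^2) * collapse (D_plus q 0 Y)
         - q {-1} * X^2 * collapse (D_plus q 0 0))"
  using arg_cong[OF D_plus_functional_equation[of X Y q], of collapse]
  by (simp only: collapse_add collapse_diff collapse_1 collapse_fps_X collapse_const)

text \<open>When the kernel \<open>P - t * K\<close> vanishes, the unknown \<open>D\<close> has the
  same coefficient on both sides and drops out, leaving a relation between \<open>D0\<close> and
  \<open>E\<close>.\<close>

lemma kernel_cancel:
  fixes D :: "'a::comm_ring_1"
  assumes "P * (D - 1) = t * (K * D + M * D0 - N * E)" "P = t * K"
  shows "t * - M * D0 = P - t * N * E"
proof -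
  have "t * - M * D0 = t * K * D - t * (K * D + M * D0 - N * E) - t * N * E"
    by (simp add: algebra_simps)
  also have "\<dots> = P - t * N * E"
    unfolding assms(1)[symmetric] assms(2)[symmetric] by (simp add: algebra_simps)
  finally show ?thesis .
qed

text \<open>Multiplying the functional equation by \<open>1 - X^2\<close> makes \<open>D0\<close>
  replaceable by its value from the kernel relation. What remains vanishes at \<open>x = X\<close>
  and therefore splits off \<open>x - X\<close>; here \<open>t * a * E\<close> plays the part of
  \<open>Y\<close>.\<close>

lemma product_form_aux:
  fixes D :: "'a::comm_ring_1"
  assumes D: "x * y * (D - 1) = t * (K * D + (x^2 - 1) * S * D0 - a * x^2 * E)"
    and D0: "t * (1 - X^2) * S * D0 = X * y - t * a * X^2 * E"
  shows "(x * y - t * K) * (1 - X^2) * D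
    = (x - X) * (y - x * (t * a * E) - X * (t * a * E) + x * y * X)"
proof -
  have "(x * y - t * K) * D = x * y * (D - 1) + x * y - t * K * D" by (simp add: algebra_simps)
  also have "\<dots> = x * y + t * (x^2 - 1) * S * D0 - t * a * x^2 * E"
    unfolding D by (simp add: algebra_simps)
  finally have "(1 - X^2) * ((x * y - t * K) * D)
      = (1 - X^2) * (x * y + t * (x^2 - 1) * S * D0 - t * a * x^2 * E)"
    by (rule arg_cong)
  also have "\<dots> = (1 - X^2) * (x * y - t * a * x^2 * E) + (x^2 - 1) * (t * (1 - X^2) * S * D0)"
    by (simp add: algebra_simps)
  finally have "(x * y - t * K) * (1 - X^2) * D
      = (1 - X^2) * (x * y - t * a * x^2 * E) + (x^2 - 1) * (t * (1 - X^2) * S * D0)"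
    by (simp only: mult.assoc mult.left_commute)
  then show ?thesis unfolding D0 by (simp add: algebra_simps power2_eq_square)
qed

text \<open>Any series \<open>X\<close> that annihilates the kernel may be substituted for
  \<open>x\<close>. This expresses \<open>D_plus p 0 y\<close> through
  \<open>D_plus p 0 0\<close>.\<close>

lemma kernel_x:
  fixes p :: "int set \<Rightarrow> 'a::comm_ring_1"
  defines "q \<equiv> \<lambda>s. fps_const (p s)"
  assumes X: "X * fps_const y = fps_X * (q {-1} + q {1} * X^2 * fps_const y^2 + q {-1, 1} * fps_const y^2)"
  shows "fps_X * (1 - X^2) * (q {-1} + q {-1, 1} * fps_const y^2) * D_plus p 0 y
     = X * fps_const y - fps_X * q {-1} * X^2 * D_plus p 0 0"
proof -
  define D where "D = collapse (D_plus q X (fps_const y))"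
  have "X * fps_const y * (D - 1)
     = fps_X * ((q {-1} + q {1} * X^2 * fps_const y^2 + q {-1, 1} * fps_const y^2) * D
         + (X^2 - 1) * (q {-1} + q {-1, 1} * fps_const y^2) * D_plus p 0 y
         - q {-1} * X^2 * D_plus p 0 0)"
    using collapse_functional_equation[of X "fps_const y" p] unfolding D_def q_def collapse_D_plus_const_0 .
  from kernel_cancel[OF this X] show ?thesis by (simp add: algebra_simps)
qed

text \<open>At \<open>x = 1\<close> the factor \<open>x^2 - 1\<close> removes
  \<open>D_plus p 0 y\<close>, so a root \<open>Y\<close> of the remaining kernel in
  \<open>y\<close> determines \<open>D_plus p 0 0\<close> alone. The assumption also admits
  \<open>p {1} + p {-1, 1} = 0\<close>, where it is linear in \<open>Y\<close>.\<close>

lemma kernel_y: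
  fixes p :: "int set \<Rightarrow> 'a::comm_ring_1"
  defines "q \<equiv> \<lambda>s. fps_const (p s)"
  assumes Y: "Y = fps_X * (q {-1} + (q {1} + q {-1, 1}) * Y^2)"
  shows "Y = fps_X * q {-1} * D_plus p 0 0"
proof -
  define D where "D = collapse (D_plus q 1 Y)"
  \<comment> \<open>The product \<open>0 * 0\<close> is the vanished term \<open>M * D0\<close> in
    the shape that \<open>kernel_cancel\<close> expects.\<close>
  have "Y * (D - 1) = fps_X * ((q {-1} + (q {1} + q {-1, 1}) * Y^2) * D + 0 * 0 - q {-1} * D_plus p 0 0)"
    using collapse_functional_equation[of 1 Y p] unfolding D_def q_def collapse_D_plus_const_0
    by (simp add: distrib_right add.assoc del: fps_const_add)
  from kernel_cancel[OF this Y] show ?thesis by simp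
qed

text \<open>The closed form without divisions, for an arbitrary kernel root \<open>X\<close>; it is
  the common source of the formulas with and without the step \<open>{1}\<close>.\<close>

lemma D_plus_product_form:
  fixes p :: "int set \<Rightarrow> 'a::comm_ring_1"
  defines "q \<equiv> \<lambda>s. fps_const (p s)"
  assumes X: "X * fps_const y = fps_X * (q {-1} + q {1} * X^2 * fps_const y^2 + q {-1, 1} * fps_const y^2)"
    and Y: "Y = fps_X * q {-1} * D_plus p 0 0"
  shows "(fps_const x * fps_const y - fps_X * (q {-1} + q {1} * fps_const x^2 * fps_const y^2
            + q {-1, 1} * fps_const y^2)) * (1 - X^2) * D_plus p x y
     = (fps_const x - X) * (fps_const y - fps_const x * Y - X * Y + fps_const x * fps_const y * X)"
proof -
  have "fps_const x * fps_const y * (D_plus p x y - 1)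
     = fps_X * ((q {-1} + q {1} * fps_const x^2 * fps_const y^2 + q {-1, 1} * fps_const y^2) * D_plus p x y
         + (fps_const x^2 - 1) * (q {-1} + q {-1, 1} * fps_const y^2) * D_plus p 0 y
         - q {-1} * fps_const x^2 * D_plus p 0 0)"
    using collapse_functional_equation[of "fps_const x" "fps_const y" p]
    unfolding q_def collapse_D_plus_const collapse_D_plus_const_0 .
  moreover note kernel_x[OF X[unfolded q_def]]
  ultimately show ?thesis unfolding Y q_def by (rule product_form_aux)
qed

lemma D_plus_at_1:
  fixes p :: "int set \<Rightarrow> 'a::comm_ring_1"
  defines "q \<equiv> \<lambda>s. fps_const (p s)"
  shows "(fps_const y - fps_X * (q {-1} + (q {1} + q {-1, 1}) * fps_const y^2)) * D_plus p 1 y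
    = fps_const y - fps_X * q {-1} * D_plus p 0 0"
proof -
  have "fps_const y * (D_plus p 1 y - 1)
     = fps_X * ((q {-1} + q {1} * fps_const y^2 + q {-1, 1} * fps_const y^2) * D_plus p 1 y
         - q {-1} * D_plus p 0 0)"
    using collapse_functional_equation[of "1" "fps_const y" p]
    unfolding q_def collapse_D_plus_const[of p 1, simplified] collapse_D_plus_const_0 by simp
  then show ?thesis by (simp add: algebra_simps)
qed

section \<open>Square roots of power series and the small kernel roots\<close>

lemma
  fixes f :: "'a::field_char_0 fps"
  assumes "f $ 0 = 1"
  shows sqrt1_power2: "sqrt1 f ^ 2 = f" and sqrt1_nth_0: "sqrt1 f $ 0 = 1"
proof -
  show "sqrt1 f ^ 2 = f"
    using power_radical[of f "\<lambda>_ _. 1" 1] assms by (simp add: sqrt1_def numeral_2_eq_2)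
  show "sqrt1 f $ 0 = 1"
    by (simp add: sqrt1_def fps_radical_def numeral_2_eq_2)
qed

lemma divide_const_fps_X:
  fixes g :: "'a::field_char_0 fps"
  assumes "k \<noteq> 0" "g $ 0 = 0"
  shows "fps_const k * fps_X * (g / (fps_const k * fps_X)) = g"
proof -
  have "g = fps_const k * fps_X * (fps_const (1 / k) * fps_shift 1 g)"
    using assms by (intro fps_ext) (auto simp: mult.assoc)
  then have "fps_const k * fps_X dvd g" by (metis dvd_triv_left)
  then show ?thesis by (rule dvd_mult_div_cancel)
qed

text \<open>Completing the square turns the quadratic equation for \<open>Z\<close> into
  \<open>(1 - 2 k t Z)^2 = 1 - 4 k l t^2\<close>. The lemma serves both \<open>Y_fun\<close> and
  \<open>X_fun\<close>.\<close>

lemma sqrt1_series_eq: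
  fixes k l :: "'a::field_char_0"
  assumes "k \<noteq> 0"
  defines "f \<equiv> 1 - fps_const (4 * k * l) * fps_X ^ 2"
  defines "Z \<equiv> (1 - sqrt1 f) / (fps_const (2 * k) * fps_X)"
  shows "2 * fps_const k * fps_X * Z = 1 - sqrt1 f"
    and "Z = fps_X * (fps_const l + fps_const k * Z ^ 2)" and "Z $ 0 = 0"
proof -
  have f: "f $ 0 = 1" by (simp add: f_def)
  have two: "fps_const (2 * k) = 2 * fps_const k"
    by (simp only: fps_const_mult[symmetric] numeral_fps_const)
  show h: "2 * fps_const k * fps_X * Z = 1 - sqrt1 f"
    using divide_const_fps_X[of "2 * k" "1 - sqrt1 f"] assms(1) sqrt1_nth_0[OF f]
    unfolding Z_def[symmetric] unfolding two by simp
  have f': "f = 1 - 4 * fps_const k * fps_const l * fps_X ^ 2"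
    by (simp only: f_def fps_const_mult[symmetric] numeral_fps_const)
  have "(1 - 2 * fps_const k * fps_X * Z) ^ 2 = 1 - 4 * fps_const k * fps_const l * fps_X ^ 2"
    using sqrt1_power2[OF f] h f' by simp
  then have "(4 * fps_const k * fps_X) * Z
      = (4 * fps_const k * fps_X) * (fps_X * (fps_const l + fps_const k * Z ^ 2))"
    by (simp add: algebra_simps power2_eq_square)
  moreover have "4 * fps_const k * fps_X \<noteq> 0" using assms(1) by simp
  ultimately show Z: "Z = fps_X * (fps_const l + fps_const k * Z ^ 2)"
    using mult_left_cancel by blast
  show "Z $ 0 = 0" by (subst Z) simp
qed

section \<open>Degrees in quadratic and biquadratic extensions\<close>

abbreviation eval_fps_poly :: "'a::field poly poly \<Rightarrow> 'a fps \<Rightarrow> 'a fps" where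
  "eval_fps_poly P f \<equiv> poly (map_poly fps_of_poly P) f"

lemma eval_fps_poly_pCons [simp]:
  "eval_fps_poly (pCons a P) f = fps_of_poly a + f * eval_fps_poly P f"
  by (simp add: map_poly_pCons)

lemma eval_fps_poly_add [simp]:
  "eval_fps_poly (P + Q) f = eval_fps_poly P f + eval_fps_poly Q f"
  by (induction P Q rule: poly_induct2) (simp_all add: fps_of_poly_add algebra_simps)

lemma eval_fps_poly_smult [simp]:
  "eval_fps_poly (smult a P) f = fps_of_poly a * eval_fps_poly P f"
  by (induction P) (simp_all add: fps_of_poly_mult algebra_simps)

lemma eval_fps_poly_diff [simp]:
  "eval_fps_poly (P - Q) f = eval_fps_poly P f - eval_fps_poly Q f"
  using eval_fps_poly_add[of P "smult (-1) Q" f] eval_fps_poly_smult[of "-1" Q f]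
  by (simp del: eval_fps_poly_add eval_fps_poly_smult add: fps_of_poly_uminus)

lemma eval_fps_poly_mult [simp]:
  "eval_fps_poly (P * Q) f = eval_fps_poly P f * eval_fps_poly Q f"
  by (induction P) (simp_all add: algebra_simps)

lemma eval_fps_poly_sum:
  "eval_fps_poly (\<Sum>i\<in>I. F i) f = (\<Sum>i\<in>I. eval_fps_poly (F i) f)"
  by (induction I rule: infinite_finite_induct) simp_all

lemma eval_fps_poly_monom: "eval_fps_poly (monom c i) f = fps_of_poly c * f ^ i"
  by (simp add: map_poly_monom poly_monom)

lemma eval_fps_poly_altdef:
  "eval_fps_poly P f = (\<Sum>i\<le>degree P. fps_of_poly (coeff P i) * f ^ i)"
proof -
  have "eval_fps_poly (\<Sum>i\<le>degree P. monom (coeff P i) i) f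
      = (\<Sum>i\<le>degree P. fps_of_poly (coeff P i) * f ^ i)"
    by (simp only: eval_fps_poly_sum eval_fps_poly_monom)
  then show ?thesis by (simp add: poly_as_sum_of_monoms)
qed

lemma map_poly_fps_of_poly_eq_0_iff: "map_poly fps_of_poly P = 0 \<longleftrightarrow> P = 0"
  by (rule map_poly_eq_0_iff) simp_all

text \<open>With \<open>n = degree P\<close>, multiplying the coefficient of index \<open>i\<close>
  by \<open>d ^ (n - i)\<close> gives \<open>Q(d f) = d^n P(f)\<close>. Thus the denominator
  \<open>d\<close> of a series can be cleared without raising the degree of its annihilator.\<close>

lemma scaled_annihilator:
  assumes "P \<noteq> 0" "d \<noteq> 0"
  shows "\<exists>Q. Q \<noteq> 0 \<and> degree Q \<le> degree P \<and>
    (\<forall>f. eval_fps_poly P f = 0 \<longrightarrow> eval_fps_poly Q (fps_of_poly d * f) = 0)"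
proof -
  define n where "n = degree P"
  define Q where "Q = (\<Sum>i\<le>n. monom (coeff P i * d ^ (n - i)) i)"
  have "coeff Q n = coeff P n"
    by (simp add: Q_def coeff_sum)
  then have "Q \<noteq> 0" using assms(1) by (auto simp: n_def)
  moreover have "degree Q \<le> n"
    unfolding Q_def by (rule degree_sum_le) (auto intro: order.trans[OF degree_monom_le])
  moreover have "eval_fps_poly Q (fps_of_poly d * f) = fps_of_poly d ^ n * eval_fps_poly P f" for f
    unfolding Q_def eval_fps_poly_sum eval_fps_poly_monom eval_fps_poly_altdef[of P] n_def[symmetric]
      sum_distrib_left
  proof (rule sum.cong[OF refl])
    fix i assume "i \<in> {..n}"
    then have "fps_of_poly d ^ n = fps_of_poly d ^ (n - i) * fps_of_poly d ^ i"
      by (simp add: power_add[symmetric])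
    then show "fps_of_poly (coeff P i * d ^ (n - i)) * (fps_of_poly d * f) ^ i
        = fps_of_poly d ^ n * (fps_of_poly (coeff P i) * f ^ i)"
      by (simp add: fps_of_poly_mult fps_of_poly_power power_mult_distrib mult_ac)
  qed
  ultimately show ?thesis unfolding n_def by (intro exI[of _ Q]) simp
qed

text \<open>The descent from the classical proof that the square root of a non-square is irrational:
  if \<open>A / B\<close> is a square root of \<open>w\<close>, then so is \<open>(B * w - (A div B) * A) / (A mod B)\<close>.\<close>

lemma square_ratio_poly:
  fixes A B w :: "'a::field poly"
  assumes "A ^ 2 = B ^ 2 * w" "B \<noteq> 0"
  shows "is_square w"
  using assms
proof (induction "degree B" arbitrary: A B rule: less_induct)
  case less
  define Q R where "Q = A div B" and "R = A mod B"
  have A: "A = Q * B + R" by (simp add: Q_def R_def)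
  show ?case
  proof (cases "R = 0")
    case True
    then have "B ^ 2 * Q ^ 2 = B ^ 2 * w" using less.prems(1) by (simp add: A power_mult_distrib mult.commute)
    then have "Q ^ 2 = w" using less.prems(2) by simp
    then show ?thesis by (auto simp: is_nth_power_def)
  next
    case False
    then have "degree R < degree B"
      using degree_mod_less[OF less.prems(2), of A] by (auto simp: R_def)
    have R: "R = A - Q * B" using A by simp
    have "(B * w - Q * A) ^ 2 = R ^ 2 * w + (B ^ 2 * w - A ^ 2) * (w - Q ^ 2)"
      unfolding R by (simp add: algebra_simps power2_eq_square)
    then have "(B * w - Q * A) ^ 2 = R ^ 2 * w" using less.prems(1) by simp
    then show ?thesis using less.hyps[OF \<open>degree R < degree B\<close>] False by blast
  qed
qed

text \<open>Squaring \<open>A = - B U\<close> gives \<open>A^2 = B^2 w\<close>, which makes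
  \<open>w\<close> a square unless \<open>B = 0\<close>.\<close>

lemma linear_independence_1_sqrt:
  fixes A B w :: "'a::field poly"
  assumes U: "U * U = fps_of_poly w" and w: "\<not> is_square w"
    and 0: "fps_of_poly A + fps_of_poly B * U = 0"
  shows "A = 0 \<and> B = 0"
proof -
  have "fps_of_poly A = - (fps_of_poly B * U)" using 0 by (simp add: eq_neg_iff_add_eq_0)
  then have "fps_of_poly A * fps_of_poly A = fps_of_poly B * fps_of_poly B * (U * U)"
    by (simp add: algebra_simps)
  then have "fps_of_poly (A ^ 2) = fps_of_poly (B ^ 2 * w)"
    unfolding U by (simp add: fps_of_poly_mult power2_eq_square)
  then have "A ^ 2 = B ^ 2 * w" by (simp only: fps_of_poly_eq_iff)
  then have "B = 0" using square_ratio_poly[of A B w] w by blast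
  then show ?thesis using 0 by simp
qed

text \<open>A relation that involves \<open>V\<close> would express \<open>V\<close> through 1 and
  \<open>U\<close>. Squaring this and comparing coordinates makes \<open>v\<close> or
  \<open>u * v\<close> a square.\<close>

lemma linear_independence_1_sqrt_sqrt:
  fixes A B C D u v :: "'a::field_char_0 poly"
  assumes U: "U * U = fps_of_poly u" and V: "V * V = fps_of_poly v"
    and ns: "\<not> is_square u" "\<not> is_square v" "\<not> is_square (u * v)"
    and 0: "fps_of_poly A + fps_of_poly B * U + fps_of_poly C * V + fps_of_poly D * U * V = 0"
  shows "A = 0 \<and> B = 0 \<and> C = 0 \<and> D = 0"
proof -
  have "C = 0 \<and> D = 0"
  proof (rule ccontr)
    assume CD: "\<not> (C = 0 \<and> D = 0)"
    \<comment> \<open>Multiplying the relation by the conjugate \<open>C - D U\<close> turns the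
      coefficient \<open>C + D U\<close> of \<open>V\<close> into the polynomial \<open>-E\<close>,
      so that \<open>E V = A2 + B2 U\<close>.\<close>
    define A2 B2 E where "A2 = A * C - B * D * u" and "B2 = B * C - A * D" and "E = D^2 * u - C^2"
    have E: "E \<noteq> 0"
    proof
      assume "E = 0"
      then have e: "C^2 = D^2 * u" by (simp add: E_def)
      then have "D = 0" using square_ratio_poly[of C D u] ns(1) by blast
      then show False using e CD by simp
    qed
    have "fps_of_poly A2 + fps_of_poly B2 * U - fps_of_poly E * V
        = (fps_of_poly A + fps_of_poly B * U + fps_of_poly C * V + fps_of_poly D * U * V)
          * (fps_of_poly C - fps_of_poly D * U)"
      unfolding A2_def B2_def E_def fps_of_poly_diff fps_of_poly_mult fps_of_poly_power U[symmetric]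
      by (simp add: algebra_simps power2_eq_square)
    then have eq: "fps_of_poly A2 + fps_of_poly B2 * U = fps_of_poly E * V" unfolding 0 by simp
    have "fps_of_poly (A2^2 + B2^2 * u - E^2 * v) + fps_of_poly (2 * A2 * B2) * U
        = (fps_of_poly A2 + fps_of_poly B2 * U)^2 - (fps_of_poly E * V)^2"
      by (simp add: fps_of_poly_add fps_of_poly_diff fps_of_poly_mult fps_of_poly_power
          U[symmetric] V[symmetric] algebra_simps power2_eq_square fps_of_poly_numeral)
    also have "\<dots> = 0" unfolding eq by simp
    finally have *: "A2^2 + B2^2 * u - E^2 * v = 0" "2 * A2 * B2 = 0"
      using linear_independence_1_sqrt[OF U ns(1)] by blast+
    from *(2) consider "A2 = 0" | "B2 = 0" by auto
    then show False
    proof cases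
      case 1
      then have "B2^2 * u = E^2 * v" using *(1) by simp
      \<comment> \<open>The extra factor \<open>u\<close> turns \<open>B2^2 * u\<close> into a
        square, and the right-hand side into \<open>E^2 * (u * v)\<close>.\<close>
      moreover have "(B2 * u)^2 = (B2^2 * u) * u" by (simp add: power2_eq_square)
      ultimately have "(B2 * u)^2 = E^2 * (u * v)" by (simp only: mult_ac)
      from square_ratio_poly[OF this E] show False
        using ns(3) by blast
    next
      case 2
      then have "A2^2 = E^2 * v" using *(1) by simp
      from square_ratio_poly[OF this E] show False
        using ns(2) by blast
    qed
  qed
  then show ?thesis using linear_independence_1_sqrt[OF U ns(1), of A B] 0 by simp
qed

text \<open>The coordinates of a polynomial expression in \<open>U\<close> and \<open>V\<close> do not depend on the choice of
  the square roots, so a relation survives every change of sign of \<open>U\<close> and \<open>V\<close>.\<close>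

lemma eval_fps_poly_biquadratic:
  fixes A B C D u v :: "'a::field poly"
  shows "\<exists>A' B' C' D'. \<forall>U V. U * U = fps_of_poly u \<longrightarrow> V * V = fps_of_poly v \<longrightarrow>
    eval_fps_poly P (fps_of_poly A + fps_of_poly B * U + fps_of_poly C * V + fps_of_poly D * U * V)
    = fps_of_poly A' + fps_of_poly B' * U + fps_of_poly C' * V + fps_of_poly D' * U * V"
proof (induction P)
  case 0
  show ?case by (rule exI[of _ 0])+ simp
next
  case (pCons a P)
  then obtain A' B' C' D' where IH: "\<And>U V. U * U = fps_of_poly u \<Longrightarrow> V * V = fps_of_poly v \<Longrightarrow>
    eval_fps_poly P (fps_of_poly A + fps_of_poly B * U + fps_of_poly C * V + fps_of_poly D * U * V)
    = fps_of_poly A' + fps_of_poly B' * U + fps_of_poly C' * V + fps_of_poly D' * U * V"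
    by metis
  show ?case
  proof (rule exI[of _ "a + A * A' + B * B' * u + C * C' * v + D * D' * u * v"],
      rule exI[of _ "A * B' + B * A' + C * D' * v + D * C' * v"],
      rule exI[of _ "A * C' + C * A' + B * D' * u + D * B' * u"],
      rule exI[of _ "A * D' + D * A' + B * C' + C * B'"], intro allI impI)
    fix U V :: "'a fps"
    assume U: "U * U = fps_of_poly u" and V: "V * V = fps_of_poly v"
    show "eval_fps_poly (pCons a P)
        (fps_of_poly A + fps_of_poly B * U + fps_of_poly C * V + fps_of_poly D * U * V)
      = fps_of_poly (a + A * A' + B * B' * u + C * C' * v + D * D' * u * v)
        + fps_of_poly (A * B' + B * A' + C * D' * v + D * C' * v) * U
        + fps_of_poly (A * C' + C * A' + B * D' * u + D * B' * u) * V
        + fps_of_poly (A * D' + D * A' + B * C' + C * B') * U * V"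
      unfolding eval_fps_poly_pCons IH[OF U V] fps_of_poly_add fps_of_poly_mult U[symmetric] V[symmetric]
      by (simp add: algebra_simps)
  qed
qed

text \<open>The annihilator of the cleared series vanishes at all four conjugates, so it has degree
  at least 4 once they are distinct. The three conditions in \<open>ne\<close> separate conjugates
  that differ in the sign of \<open>U\<close>, of \<open>V\<close>, and of both.\<close>

lemma biquadratic_degree_ge:
  fixes A B C D u v :: "'a::field_char_0 poly"
  assumes U: "U * U = fps_of_poly u" and V: "V * V = fps_of_poly v"
    and ns: "\<not> is_square u" "\<not> is_square v" "\<not> is_square (u * v)"
    and d: "d \<noteq> 0" and f: "fps_of_poly d * f
      = fps_of_poly A + fps_of_poly B * U + fps_of_poly C * V + fps_of_poly D * U * V"
    and ne: "B \<noteq> 0 \<or> D \<noteq> 0" "C \<noteq> 0 \<or> D \<noteq> 0" "B \<noteq> 0 \<or> C \<noteq> 0"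
    and P: "annihilates P f"
  shows "4 \<le> degree P"
proof -
  define z where "z U V = fps_of_poly A + fps_of_poly B * U + fps_of_poly C * V + fps_of_poly D * U * V"
    for U V
  have P': "P \<noteq> 0" "eval_fps_poly P f = 0" using P by (auto simp: annihilates_def)
  obtain Q where Q: "Q \<noteq> 0" "degree Q \<le> degree P" "eval_fps_poly Q (z U V) = 0"
    using scaled_annihilator[OF P'(1) d] P'(2) f unfolding z_def by metis
  obtain A' B' C' D' where ev: "\<And>U V. U * U = fps_of_poly u \<Longrightarrow> V * V = fps_of_poly v \<Longrightarrow>
      eval_fps_poly Q (z U V)
      = fps_of_poly A' + fps_of_poly B' * U + fps_of_poly C' * V + fps_of_poly D' * U * V"
    unfolding z_def using eval_fps_poly_biquadratic[of u v Q A B C D] by metis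
  \<comment> \<open>The coordinates of \<open>Q\<close> at \<open>z U V\<close> vanish by
    independence, and the same coordinates describe \<open>Q\<close> at every conjugate.\<close>
  have "A' = 0 \<and> B' = 0 \<and> C' = 0 \<and> D' = 0"
    using ev[OF U V] Q(3) by (intro linear_independence_1_sqrt_sqrt[OF U V ns]) simp
  then have root: "eval_fps_poly Q (z U' V') = 0"
    if "U' * U' = fps_of_poly u" "V' * V' = fps_of_poly v" for U' V'
    using ev[OF that] by simp
  have indep: "fps_of_poly A + fps_of_poly B * U + fps_of_poly C * V + fps_of_poly D * U * V \<noteq> 0"
    if "B \<noteq> 0 \<or> C \<noteq> 0 \<or> D \<noteq> 0" for A B C D
    using linear_independence_1_sqrt_sqrt[OF U V ns] that by blast
  have neqI: "f \<noteq> g" if "f - g = 2 * h" "h \<noteq> 0" for f g h :: "'a fps"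
    using that by auto
  \<comment> \<open>Each difference is written with all four coordinates, zeros included, so that
    \<open>indep\<close> applies verbatim.\<close>
  have eq: "z U V - z (-U) V = 2 * (fps_of_poly 0 + fps_of_poly B * U + fps_of_poly 0 * V + fps_of_poly D * U * V)"
    "z U (-V) - z (-U) (-V) = 2 * (fps_of_poly 0 + fps_of_poly B * U + fps_of_poly 0 * V + fps_of_poly (-D) * U * V)"
    "z U V - z U (-V) = 2 * (fps_of_poly 0 + fps_of_poly 0 * U + fps_of_poly C * V + fps_of_poly D * U * V)"
    "z (-U) V - z (-U) (-V) = 2 * (fps_of_poly 0 + fps_of_poly 0 * U + fps_of_poly C * V + fps_of_poly (-D) * U * V)"
    "z U V - z (-U) (-V) = 2 * (fps_of_poly 0 + fps_of_poly B * U + fps_of_poly C * V + fps_of_poly 0 * U * V)"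
    "z U (-V) - z (-U) V = 2 * (fps_of_poly 0 + fps_of_poly B * U + fps_of_poly (-C) * V + fps_of_poly 0 * U * V)"
    by (simp_all add: z_def fps_of_poly_uminus algebra_simps)
  have "z U V \<noteq> z (-U) V" by (rule neqI[OF eq(1) indep]) (use ne in auto)
  moreover have "z U (-V) \<noteq> z (-U) (-V)" by (rule neqI[OF eq(2) indep]) (use ne in auto)
  moreover have "z U V \<noteq> z U (-V)" by (rule neqI[OF eq(3) indep]) (use ne in auto)
  moreover have "z (-U) V \<noteq> z (-U) (-V)" by (rule neqI[OF eq(4) indep]) (use ne in auto)
  moreover have "z U V \<noteq> z (-U) (-V)" by (rule neqI[OF eq(5) indep]) (use ne in auto)
  moreover have "z U (-V) \<noteq> z (-U) V" by (rule neqI[OF eq(6) indep]) (use ne in auto)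
  ultimately have "4 = card {z U V, z (-U) V, z U (-V), z (-U) (-V)}"
    by simp
  also have "\<dots> \<le> card {f. eval_fps_poly Q f = 0}"
    using U V Q(1)
    by (intro card_mono poly_roots_finite) (auto intro!: root simp: map_poly_fps_of_poly_eq_0_iff)
  also have "\<dots> \<le> degree (map_poly fps_of_poly Q)"
    using Q(1) by (intro card_poly_roots_bound) (simp add: map_poly_fps_of_poly_eq_0_iff)
  also have "\<dots> \<le> degree Q" by (rule map_poly_degree_leq)
  finally show ?thesis using Q(2) by simp
qed

text \<open>A relation \<open>a + b f = 0\<close>, multiplied by \<open>d\<close>, is a relation
  between 1 and \<open>U\<close> in which \<open>U\<close> has coefficient \<open>B * b\<close>;
  independence gives \<open>b = 0\<close> and then \<open>a = 0\<close>.\<close>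

lemma quadratic_degree_ge:
  fixes A B u :: "'a::field_char_0 poly"
  assumes U: "U * U = fps_of_poly u" and ns: "\<not> is_square u"
    and d: "d \<noteq> 0" and f: "fps_of_poly d * f = fps_of_poly A + fps_of_poly B * U" and B: "B \<noteq> 0"
    and P: "annihilates P f"
  shows "2 \<le> degree P"
proof (rule ccontr)
  assume "\<not> 2 \<le> degree P"
  then have "degree P \<le> 1" by simp
  then have P1: "P = [:coeff P 0, coeff P 1:]"
    by (intro poly_eqI) (auto simp: coeff_pCons coeff_eq_0 split: nat.split)
  define a b where "a = coeff P 0" and "b = coeff P 1"
  have "fps_of_poly a + f * fps_of_poly b = 0"
    using P P1 unfolding annihilates_def a_def b_def
    by (metis eval_fps_poly_pCons map_poly_0 poly_0 mult_zero_right add_0_right)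
  then have "fps_of_poly d * fps_of_poly a + (fps_of_poly d * f) * fps_of_poly b = 0"
    by (simp add: mult.assoc distrib_left[symmetric])
  then have "fps_of_poly (d * a + A * b) + fps_of_poly (B * b) * U = 0"
    unfolding f by (simp add: fps_of_poly_add fps_of_poly_mult algebra_simps)
  then have "d * a + A * b = 0" "B * b = 0" using linear_independence_1_sqrt[OF U ns] by blast+
  then have "a = 0" "b = 0" using B d by auto
  then show False using P P1 by (simp add: a_def b_def annihilates_def)
qed

text \<open>The polynomial expands \<open>(d f - A)^2 = B^2 u\<close>; its leading coefficient
  \<open>d^2\<close> is nonzero even if \<open>B = 0\<close>.\<close>

lemma quadratic_annihilator:
  fixes A B u :: "'a::field_char_0 poly"
  assumes U: "U * U = fps_of_poly u"
    and d: "d \<noteq> 0" and f: "fps_of_poly d * f = fps_of_poly A + fps_of_poly B * U"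
  shows "\<exists>P. annihilates P f \<and> degree P = 2"
proof -
  define P where "P = [:A^2 - B^2 * u, -2 * d * A, d^2:]"
  have "eval_fps_poly P f = (fps_of_poly d * f - fps_of_poly A)^2 - (fps_of_poly B)^2 * fps_of_poly u"
    unfolding P_def by (simp add: fps_of_poly_add fps_of_poly_diff fps_of_poly_mult fps_of_poly_power
        fps_of_poly_uminus fps_of_poly_numeral algebra_simps power2_eq_square)
  also have "\<dots> = 0" unfolding f U[symmetric] by (simp add: power2_eq_square)
  finally show ?thesis using d by (intro exI[of _ P]) (auto simp: annihilates_def P_def)
qed

text \<open>The two roots are eliminated in turn: with \<open>L = d f - A\<close>, squaring
  \<open>L - B U = (C + D U) V\<close> removes \<open>V\<close>, and squaring once more removes
  \<open>U\<close>.\<close>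

lemma biquadratic_annihilator:
  fixes A B C D u v :: "'a::field_char_0 poly"
  assumes U: "U * U = fps_of_poly u" and V: "V * V = fps_of_poly v"
    and d: "d \<noteq> 0" and f: "fps_of_poly d * f
      = fps_of_poly A + fps_of_poly B * U + fps_of_poly C * V + fps_of_poly D * U * V"
  shows "\<exists>P. annihilates P f \<and> degree P = 4"
proof -
  define L where "L = [:-A, d:]"
  \<comment> \<open>Sorting the first squared equation by \<open>U\<close> gives
    \<open>S = 2 U T\<close>. Squaring this gives \<open>P\<close>, whose degree is that of
    \<open>S * S\<close>, since \<open>T\<close> has degree at most 1.\<close>
  define S where "S = L * L + [:B^2 * u - C^2 * v - D^2 * u * v:]"
  define T where "T = smult B L + [:C * D * v:]"
  define P where "P = S * S - smult (4 * u) (T * T)"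
  have L: "eval_fps_poly L f = fps_of_poly B * U + fps_of_poly C * V + fps_of_poly D * U * V"
    using f by (simp add: L_def fps_of_poly_uminus algebra_simps)
  have ST: "eval_fps_poly S f = 2 * U * eval_fps_poly T f"
    unfolding S_def T_def
    by (simp add: L fps_of_poly_add fps_of_poly_diff fps_of_poly_mult fps_of_poly_power
        U[symmetric] V[symmetric] power2_eq_square algebra_simps)
  have "eval_fps_poly P f = 0"
    by (simp add: P_def ST fps_of_poly_mult fps_of_poly_numeral U[symmetric] algebra_simps)
  have "degree L = 1" "L \<noteq> 0" using d by (simp_all add: L_def)
  then have "degree (L * L) = 2" using degree_mult_eq[of L L] by simp
  then have "degree S = 2" unfolding S_def by (subst degree_add_eq_left) auto
  moreover from this have "S \<noteq> 0" by auto
  ultimately have "degree (S * S) = 4" using degree_mult_eq[of S S] by simp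
  have "degree T \<le> 1"
    unfolding T_def using \<open>degree L = 1\<close>
    by (intro degree_add_le) (auto intro: order.trans[OF degree_smult_le])
  then have "degree (smult (4 * u) (T * T)) \<le> 2"
    using degree_mult_le[of T T] degree_smult_le[of "4 * u" "T * T"] by linarith
  with \<open>degree (S * S) = 4\<close> have "degree P = 4" unfolding P_def diff_conv_add_uminus
    by (subst degree_add_eq_left) auto
  moreover from this have "P \<noteq> 0" by auto
  ultimately show ?thesis using \<open>eval_fps_poly P f = 0\<close> by (auto simp: annihilates_def)
qed

lemma algebraic_degree_eqI:
  assumes "\<exists>P. annihilates P f \<and> degree P = n" "\<And>P. annihilates P f \<Longrightarrow> n \<le> degree P"
  shows "algebraic_degree f = n"
  unfolding algebraic_degree_def using assms by (intro Least_equality) auto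

lemma algebraic_degree_leI:
  assumes "\<exists>P. annihilates P f \<and> degree P = n"
  shows "algebraic_fps f \<and> algebraic_degree f \<le> n"
  using assms unfolding algebraic_fps_def algebraic_degree_def by (auto intro: Least_le)

section \<open>Degrees for the square roots of 1 - \<alpha> t^2 and 1 - \<beta> t^2\<close>

text \<open>A root would be linear, \<open>b + a t\<close> with \<open>a \<noteq> 0\<close>, but
  then \<open>b^2 = 1\<close> contradicts the vanishing of the middle coefficient
  \<open>2 a b\<close>.\<close>

lemma not_is_square_1_minus:
  fixes \<alpha> :: "'a::field_char_0"
  assumes "\<alpha> \<noteq> 0"
  shows "\<not> is_square [:1, 0, -\<alpha>:]"
proof
  assume "is_square [:1, 0, -\<alpha>:]"
  then obtain Q where Q: "Q * Q = [:1, 0, -\<alpha>:]" by (metis is_nth_power_def power2_eq_square)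
  then have "Q \<noteq> 0" by auto
  then have "degree Q + degree Q = 2" using degree_mult_eq[of Q Q] Q assms by simp
  then have "degree Q = 1" by simp
  then obtain a b where "Q = [:b, a:]" "a \<noteq> 0" by (rule degree1_coeffs)
  then show False using Q assms by auto
qed

text \<open>For a quadratic root \<open>a + b t + c t^2\<close> the low coefficients give
  \<open>a^2 = 1\<close> and \<open>b = 0\<close>. The others then give
  \<open>(\<alpha> + \<beta>)^2 = 4 \<alpha> \<beta>\<close>, that is
  \<open>\<alpha> = \<beta>\<close>.\<close>

lemma not_is_square_mult:
  fixes \<alpha> \<beta> :: "'a::field_char_0"
  assumes "\<alpha> \<noteq> 0" "\<beta> \<noteq> 0" "\<alpha> \<noteq> \<beta>"
  shows "\<not> is_square ([:1, 0, -\<alpha>:] * [:1, 0, -\<beta>:])"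
proof
  assume "is_square ([:1, 0, -\<alpha>:] * [:1, 0, -\<beta>:])"
  then obtain Q where "Q * Q = [:1, 0, -\<alpha>:] * [:1, 0, -\<beta>:]"
    by (metis is_nth_power_def power2_eq_square)
  then have Q: "Q * Q = [:1, 0, -(\<alpha> + \<beta>), 0, \<alpha> * \<beta>:]" by (simp add: algebra_simps)
  then have "Q \<noteq> 0" by auto
  then have "degree Q + degree Q = 4" using degree_mult_eq[of Q Q] Q assms by simp
  then have "degree Q = 2" by simp
  then obtain a b c where q: "Q = [:a, b, c:]" by (rule degree2_coeffs)
  have eqs: "coeff (Q * Q) i = coeff [:1, 0, -(\<alpha> + \<beta>), 0, \<alpha> * \<beta>:] i" for i
    unfolding Q ..
  have a: "a * a = 1" using eqs[of 0] by (simp add: q)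
  have "a * b = 0" using eqs[of 1] by (simp add: q mult.commute[of b a] mult_2[symmetric] del: mult_eq_0_iff)
  then have "b = 0" using a by (metis mult_zero_left no_zero_divisors zero_neq_one)
  have c: "c * c = \<alpha> * \<beta>" using eqs[of 4] by (simp add: q numeral_eq_Suc)
  have "a * c + b * b + c * a = -(\<alpha> + \<beta>)" using eqs[of 2] by (simp add: q numeral_eq_Suc algebra_simps)
  then have "2 * a * c = -(\<alpha> + \<beta>)"
    using \<open>b = 0\<close> by (simp add: algebra_simps)
  then have "(2 * a * c)^2 = (\<alpha> + \<beta>)^2" by (simp only: power2_minus)
  moreover have "(2 * a * c)^2 = 4 * (a * a) * (c * c)" by (simp add: power2_eq_square)
  ultimately have "(\<alpha> + \<beta>)^2 = 4 * (\<alpha> * \<beta>)"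
    unfolding a c by simp
  moreover have "(\<alpha> - \<beta>)^2 = (\<alpha> + \<beta>)^2 - 4 * (\<alpha> * \<beta>)"
    by (simp add: power2_eq_square algebra_simps)
  ultimately have "(\<alpha> - \<beta>)^2 = 0" by simp
  then show False using assms(3) by simp
qed

lemma fps_of_poly_1_minus:
  "fps_of_poly [:1, 0, -\<alpha>:] = 1 - fps_const \<alpha> * (fps_X * fps_X :: 'a::comm_ring_1 fps)"
  by (intro fps_ext) (auto simp: fps_X_mult_nth coeff_pCons numeral_2_eq_2 split: nat.splits)

lemma quadratic_degree_2:
  fixes \<alpha> :: "'a::field_char_0"
  assumes "U ^ 2 = 1 - fps_const \<alpha> * fps_X ^ 2" "\<alpha> \<noteq> 0"
    and "d \<noteq> 0" "fps_of_poly d * f = fps_of_poly A + fps_of_poly B * U" "B \<noteq> 0"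
  shows "algebraic_degree f = 2"
proof -
  have U: "U * U = fps_of_poly [:1, 0, -\<alpha>:]"
    using assms(1) by (simp add: fps_of_poly_1_minus power2_eq_square)
  show ?thesis
    by (rule algebraic_degree_eqI[OF quadratic_annihilator[OF U assms(3,4)]
          quadratic_degree_ge[OF U not_is_square_1_minus[OF assms(2)] assms(3-5)]])
qed

lemma quadratic_degree_le_2:
  fixes \<alpha> :: "'a::field_char_0"
  assumes "U ^ 2 = 1 - fps_const \<alpha> * fps_X ^ 2"
    and "d \<noteq> 0" "fps_of_poly d * f = fps_of_poly A + fps_of_poly B * U"
  shows "algebraic_fps f \<and> algebraic_degree f \<le> 2"
proof -
  have U: "U * U = fps_of_poly [:1, 0, -\<alpha>:]"
    using assms(1) by (simp add: fps_of_poly_1_minus power2_eq_square)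
  show ?thesis by (rule algebraic_degree_leI[OF quadratic_annihilator[OF U assms(2,3)]])
qed

lemma biquadratic_degree_4:
  fixes \<alpha> \<beta> :: "'a::field_char_0"
  assumes "U ^ 2 = 1 - fps_const \<alpha> * fps_X ^ 2" "V ^ 2 = 1 - fps_const \<beta> * fps_X ^ 2"
    and "\<alpha> \<noteq> 0" "\<beta> \<noteq> 0" "\<alpha> \<noteq> \<beta>" and "d \<noteq> 0"
    and "fps_of_poly d * f
      = fps_of_poly A + fps_of_poly B * U + fps_of_poly C * V + fps_of_poly D * U * V"
    and "C \<noteq> 0" "D \<noteq> 0"
  shows "algebraic_degree f = 4"
proof -
  have U: "U * U = fps_of_poly [:1, 0, -\<alpha>:]" and V: "V * V = fps_of_poly [:1, 0, -\<beta>:]"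
    using assms(1,2) by (simp_all add: fps_of_poly_1_minus power2_eq_square)
  note not_square = not_is_square_1_minus[OF assms(3)] not_is_square_1_minus[OF assms(4)]
    not_is_square_mult[OF assms(3-5)]
  show ?thesis
  proof (rule algebraic_degree_eqI[OF biquadratic_annihilator[OF U V assms(6,7)]])
    fix P assume "annihilates P f"
    \<comment> \<open>Nonzero \<open>C\<close> and \<open>D\<close> already imply all three
      separation conditions, whatever \<open>B\<close> is.\<close>
    then show "4 \<le> degree P"
      by (intro biquadratic_degree_ge[OF U V not_square assms(6,7)]) (use assms(8,9) in simp_all)
  qed
qed

lemma biquadratic_degree_le_4:
  fixes \<alpha> \<beta> :: "'a::field_char_0"
  assumes "U ^ 2 = 1 - fps_const \<alpha> * fps_X ^ 2" "V ^ 2 = 1 - fps_const \<beta> * fps_X ^ 2"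
    and "d \<noteq> 0" and "fps_of_poly d * f
      = fps_of_poly A + fps_of_poly B * U + fps_of_poly C * V + fps_of_poly D * U * V"
  shows "algebraic_fps f \<and> algebraic_degree f \<le> 4"
proof -
  have U: "U * U = fps_of_poly [:1, 0, -\<alpha>:]" and V: "V * V = fps_of_poly [:1, 0, -\<beta>:]"
    using assms(1,2) by (simp_all add: fps_of_poly_1_minus power2_eq_square)
  show ?thesis by (rule algebraic_degree_leI[OF biquadratic_annihilator[OF U V assms(3,4)]])
qed

section \<open>Clearing denominators in the closed form\<close>

lemma Y_fun_eq:
  fixes p :: "int set \<Rightarrow> 'a::field_char_0"
  assumes "p {1} + p {-1, 1} \<noteq> 0"
  shows "fps_const (2 * (p {1} + p {-1, 1})) * fps_X * Y_fun p
      = 1 - sqrt1 (1 - fps_const (4 * p {-1} * (p {1} + p {-1, 1})) * fps_X ^ 2)"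
    and "Y_fun p = fps_X * fps_const (p {-1}) * D_plus p 0 0"
proof -
  define k where "k = p {1} + p {-1, 1}"
  have k: "k \<noteq> 0" using assms by (simp add: k_def)
  have f: "4 * p {-1} * k = 4 * k * p {-1}" by simp
  have Y: "Y_fun p = (1 - sqrt1 (1 - fps_const (4 * k * p {-1}) * fps_X ^ 2)) / (fps_const (2 * k) * fps_X)"
    unfolding Y_fun_def k_def[symmetric] f ..
  have two: "fps_const (2 * k) = 2 * fps_const k"
    by (simp only: fps_const_mult[symmetric] numeral_fps_const)
  note s = sqrt1_series_eq[OF k, of "p {-1}", folded Y]
  show "fps_const (2 * (p {1} + p {-1, 1})) * fps_X * Y_fun p
      = 1 - sqrt1 (1 - fps_const (4 * p {-1} * (p {1} + p {-1, 1})) * fps_X ^ 2)"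
    unfolding k_def[symmetric] f two using s(1) .
  show "Y_fun p = fps_X * fps_const (p {-1}) * D_plus p 0 0"
    by (rule kernel_y) (use s(2) in \<open>simp add: k_def\<close>)
qed

lemma X_fun_eq:
  fixes p :: "int set \<Rightarrow> 'a::field_char_0"
  assumes "p {1} \<noteq> 0" "y \<noteq> 0"
  shows "fps_const (2 * p {1} * y) * fps_X * X_fun p y
      = 1 - sqrt1 (1 - fps_const (4 * p {1} * (p {-1} + p {-1, 1} * y ^ 2)) * fps_X ^ 2)"
    and "X_fun p y * fps_const y = fps_X * (fps_const (p {-1})
      + fps_const (p {1}) * X_fun p y ^ 2 * fps_const y ^ 2 + fps_const (p {-1, 1}) * fps_const y ^ 2)"
    and "X_fun p y $ 0 = 0"
proof -
  \<comment> \<open>Dividing the kernel equation by \<open>y\<close> brings it to the form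
    \<open>X = t (l + k X^2)\<close>.\<close>
  define k l where "k = p {1} * y" and "l = (p {-1} + p {-1, 1} * y ^ 2) / y"
  have k: "k \<noteq> 0" using assms by (simp add: k_def)
  have f: "4 * p {1} * (p {-1} + p {-1, 1} * y ^ 2) = 4 * k * l" "2 * p {1} * y = 2 * k"
    using assms(2) by (simp_all add: k_def l_def)
  have X: "X_fun p y = (1 - sqrt1 (1 - fps_const (4 * k * l) * fps_X ^ 2)) / (fps_const (2 * k) * fps_X)"
    unfolding X_fun_def f ..
  have two: "fps_const (2 * k) = 2 * fps_const k"
    by (simp only: fps_const_mult[symmetric] numeral_fps_const)
  note s = sqrt1_series_eq[OF k, of l, folded X]
  show "fps_const (2 * p {1} * y) * fps_X * X_fun p y
      = 1 - sqrt1 (1 - fps_const (4 * p {1} * (p {-1} + p {-1, 1} * y ^ 2)) * fps_X ^ 2)"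
    unfolding f two using s(1) .
  show "X_fun p y $ 0 = 0" by (rule s(3))
  have ly: "fps_const l * fps_const y = fps_const (p {-1}) + fps_const (p {-1, 1}) * fps_const y ^ 2"
    using assms(2) by (simp add: l_def fps_const_power)
  have "X_fun p y * fps_const y
      = fps_X * (fps_const l * fps_const y + fps_const k * X_fun p y ^ 2 * fps_const y)"
    by (subst s(2)) (simp add: algebra_simps del: fps_const_mult)
  also have "fps_const k * X_fun p y ^ 2 * fps_const y = fps_const (p {1}) * X_fun p y ^ 2 * fps_const y ^ 2"
    unfolding k_def fps_const_mult[symmetric] by (simp add: power2_eq_square mult_ac del: fps_const_mult)
  finally show "X_fun p y * fps_const y = fps_X * (fps_const (p {-1})
      + fps_const (p {1}) * X_fun p y ^ 2 * fps_const y ^ 2 + fps_const (p {-1, 1}) * fps_const y ^ 2)"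
    unfolding ly by (simp only: add_ac)
qed

text \<open>Stated for \<open>t * p {-1} * D_plus p 0 0\<close> in place of \<open>Y_fun p\<close>,
  because the quotient defining \<open>Y_fun\<close> has denominator 0 when
  \<open>p {1} + p {-1, 1} = 0\<close>. In that case the kernel is linear and the series is simply
  \<open>t * p {-1}\<close>.\<close>

lemma fps_Y_quadratic:
  fixes p :: "int set \<Rightarrow> 'a::field_char_0"
  defines "V \<equiv> sqrt1 (1 - fps_const (4 * p {-1} * (p {1} + p {-1, 1})) * fps_X ^ 2)"
  obtains g A B where "g \<noteq> 0"
    and "fps_of_poly g * (fps_X * fps_const (p {-1}) * D_plus p 0 0) = fps_of_poly A + fps_of_poly B * V"
    and "p {1} + p {-1, 1} \<noteq> 0 \<Longrightarrow> B \<noteq> 0"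
proof (cases "p {1} + p {-1, 1} = 0")
  case True
  have "fps_X * fps_const (p {-1}) = fps_X * fps_const (p {-1}) * D_plus p 0 0"
    by (rule kernel_y) (simp add: True)
  then show ?thesis
    using True by (intro that[of 1 "[:0, p {-1}:]" 0]) (simp_all add: fps_of_poly_pCons)
next
  case False
  have "fps_of_poly [:0, 2 * (p {1} + p {-1, 1}):] = fps_const (2 * (p {1} + p {-1, 1})) * fps_X"
    by (simp add: fps_of_poly_pCons mult.commute)
  then have "fps_of_poly [:0, 2 * (p {1} + p {-1, 1}):] * (fps_X * fps_const (p {-1}) * D_plus p 0 0)
      = fps_of_poly 1 + fps_of_poly (-1) * V"
    unfolding Y_fun_eq(2)[OF False, symmetric] V_def
    by (simp only: Y_fun_eq(1)[OF False]) (simp add: fps_of_poly_uminus)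
  then show ?thesis
  proof (rule that[rotated])
    show "[:0, 2 * (p {1} + p {-1, 1}):] \<noteq> 0"
      using False by (simp add: distrib_left[symmetric] del: distrib_left_numeral)
  qed simp
qed

text \<open>Without the step \<open>{1}\<close> the kernel equals \<open>y * (x - X)\<close>, so the
  factor \<open>x - X\<close> cancels from the product form. A further factor \<open>y\<close> turns
  \<open>X * y\<close> into \<open>t * s\<close>.\<close>

lemma no_up_step_aux:
  fixes D :: "'a::idom"
  assumes "(x * y - t * s) * (1 - X^2) * D = (x - X) * (y - x * Y - X * Y + x * y * X)"
    and X: "X * y = t * s" and "x - X \<noteq> 0"
  shows "(y^2 - t^2 * s^2) * D = y^2 - x * y * Y - t * s * (Y - x * y)"
proof -
  have "(x - X) * (y * (1 - X^2) * D) = (x - X) * (y - x * Y - X * Y + x * y * X)"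
    unfolding assms(1)[symmetric] X[symmetric] by (simp add: algebra_simps)
  then have eq: "y * (1 - X^2) * D = y - x * Y - X * Y + x * y * X"
    using assms(3) mult_left_cancel by blast
  have "(y^2 - t^2 * s^2) * D = y * (y * (1 - X^2) * D)"
    unfolding power_mult_distrib[symmetric] X[symmetric] by (simp add: algebra_simps power2_eq_square)
  also have "\<dots> = y^2 - x * y * Y - (X * y) * (Y - x * y)"
    unfolding eq by (simp add: algebra_simps power2_eq_square)
  finally show ?thesis unfolding X .
qed

lemma D_plus_no_up_step:
  fixes p :: "int set \<Rightarrow> 'a::field_char_0"
  assumes "p {1} = 0" "y \<noteq> 0" "x \<noteq> 0 \<or> p {-1} + p {-1, 1} * y ^ 2 \<noteq> 0"
  defines "s \<equiv> p {-1, 1} * y ^ 2 + p {-1}" and "Y \<equiv> fps_X * fps_const (p {-1}) * D_plus p 0 0"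
  shows "(fps_const (y^2) - fps_X^2 * fps_const (s^2)) * D_plus p x y
     = fps_const (y^2) - fps_const (x * y) * Y - fps_X * fps_const s * (Y - fps_const (x * y))"
proof -
  \<comment> \<open>For \<open>p {1} = 0\<close> the kernel is linear in \<open>x\<close>, with this
    root; the quotient defining \<open>X_fun\<close> would have denominator 0.\<close>
  define X where "X = fps_X * fps_const (s / y)"
  have s: "fps_const (p {-1}) + fps_const (p {1}) * X^2 * fps_const y^2
      + fps_const (p {-1, 1}) * fps_const y^2 = fps_const s"
    by (simp add: assms(1) s_def fps_const_power add.commute)
  have s': "fps_const (p {-1}) + fps_const (p {1}) * fps_const x^2 * fps_const y^2
      + fps_const (p {-1, 1}) * fps_const y^2 = fps_const s"
    by (simp add: assms(1) s_def fps_const_power add.commute)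
  have X: "X * fps_const y = fps_X * fps_const s"
    using assms(2) by (simp add: X_def mult.assoc)
  have "(fps_const x - X) $ 0 = x" "(fps_const x - X) $ 1 = - (s / y)" by (simp_all add: X_def)
  then have "fps_const x - X \<noteq> 0"
    using assms(2,3) unfolding s_def by (metis add.commute divide_eq_0_iff fps_zero_nth neg_equal_0_iff_equal)
  from no_up_step_aux[OF D_plus_product_form[of X y p Y x, unfolded s s', OF X Y_def[THEN meta_eq_to_obj_eq]] X this]
  show ?thesis by (simp add: fps_const_power)
qed

text \<open>With \<open>U * U = u\<close> one has \<open>h^2 * (1 - X^2) = m + 2 * U\<close>, so the denominator \<open>1 - X^2\<close> is cleared
  by multiplying with the conjugate \<open>m - 2 * U\<close>.\<close>

lemma biquadratic_form_aux:
  fixes D :: "'a::comm_ring_1"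
  assumes D: "\<kappa> * (1 - X^2) * D = (x - X) * (y - x * Y - X * Y + x * y * X)"
    and X: "h * X = 1 - U" and Y: "g * Y = 1 - V" and U: "U * U = u"
  defines "m \<equiv> h^2 - 1 - u" and "r \<equiv> h * x - 1" and "n \<equiv> h * x + 1" and "l \<equiv> g * (h * y + x * y)"
  defines "e0 \<equiv> r * m - 2 * u" and "e1 \<equiv> m - 2 * r"
  shows "\<kappa> * g * (m^2 - 4 * u) * D
    = (e0 * (l - n) + e1 * (1 - g * x * y) * u) + (e0 * (1 - g * x * y) + e1 * (l - n)) * U
      + (e0 * n - e1 * u) * V + (e1 * n - e0) * U * V"
proof -
  have "m^2 - 4 * u = (m - 2 * U) * (m + 2 * U)" by (simp add: algebra_simps power2_eq_square U[symmetric])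
  also have "m + 2 * U = h^2 - (1 - U)^2" by (simp add: m_def algebra_simps power2_eq_square U[symmetric])
  also have "\<dots> = h^2 * (1 - X^2)" unfolding X[symmetric] by (simp add: algebra_simps power_mult_distrib)
  finally have "\<kappa> * g * (m^2 - 4 * u) * D = (m - 2 * U) * (h^2 * g * (\<kappa> * (1 - X^2) * D))"
    by (simp only: mult_ac)
  also have "h^2 * g * (\<kappa> * (1 - X^2) * D)
      = (h * x - h * X) * (g * (h * y + x * y * (h * X)) - g * Y * (h * x + h * X))"
    unfolding D by (simp add: algebra_simps power2_eq_square)
  also have "\<dots> = (r + U) * ((l - n) + (1 - g * x * y) * U + n * V - U * V)"
    unfolding X Y by (simp add: r_def n_def l_def algebra_simps)
  also have "(m - 2 * U) * ((r + U) * ((l - n) + (1 - g * x * y) * U + n * V - U * V))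
      = (m * r - 2 * (U * U) + (m - 2 * r) * U) * ((l - n) + (1 - g * x * y) * U + n * V - U * V)"
    by (simp add: algebra_simps)
  also have "\<dots> = (e0 + e1 * U) * ((l - n) + (1 - g * x * y) * U + n * V - U * V)"
    unfolding U e0_def e1_def by (simp only: mult.commute)
  also have "\<dots> = (e0 * (l - n) + e1 * (1 - g * x * y) * (U * U)) + (e0 * (1 - g * x * y) + e1 * (l - n)) * U
      + (e0 * n - e1 * (U * U)) * V + (e1 * n - e0) * U * V"
    by (simp add: algebra_simps)
  finally show ?thesis unfolding U .
qed

text \<open>These expansions in \<open>t\<close> make it visible when the coefficients from
  \<open>biquadratic_form_aux\<close> are nonzero. In order they concern the denominator, the
  coefficients of \<open>U V\<close> and of \<open>V\<close>, the sum that remains when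
  \<open>V = 1\<close>, and the sum that remains when \<open>U = V\<close> and
  \<open>x = 0\<close>.\<close>

lemma biquadratic_coefficients:
  fixes x y k t g \<alpha> :: "'a::comm_ring_1"
  defines "u \<equiv> 1 - \<alpha> * t^2" and "h \<equiv> k * t"
  defines "m \<equiv> h^2 - 1 - u" and "r \<equiv> h * x - 1" and "n \<equiv> h * x + 1" and "l \<equiv> g * (h * y + x * y)"
  defines "e0 \<equiv> r * m - 2 * u" and "e1 \<equiv> m - 2 * r"
  shows "m^2 - 4 * u = t^2 * (- 4 * k^2 + t^2 * (k^2 + \<alpha>)^2)"
    and "e1 * n - e0 = 2 * k^2 * (1 - x^2) * t^2"
    and "e0 * n - e1 * u = t^2 * (- 2 * k^2 * (x^2 + 1) + t^2 * ((k^2 + \<alpha>) * (k^2 * x^2 + \<alpha>)))"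
    and "e0 * (1 - g * x * y) + e1 * (l - n) + (e1 * n - e0) = g * y * ((\<alpha> + k^2) * k * (1 - x^2) * t^3)"
    and "x = 0 \<Longrightarrow> e0 * (1 - g * x * y) + e1 * (l - n) + (e0 * n - e1 * u)
      = t^2 * (- 4 * k^2 + (k^2 + \<alpha>) * (g * k * y * t + \<alpha> * t^2))"
  by (simp_all add: u_def h_def m_def r_def n_def l_def e0_def e1_def algebra_simps
      power2_eq_square power3_eq_cube)

text \<open>The value \<open>x = 0\<close> is included for the sake of the excursions. The
  conclusions about \<open>B + D\<close> and \<open>B + C\<close> prepare the degenerate cases
  \<open>V = 1\<close> and \<open>U = V\<close>.\<close>

lemma D_plus_biquadratic:
  fixes p :: "int set \<Rightarrow> 'a::field_char_0"
  assumes b: "p {1} \<noteq> 0" and y: "y \<noteq> 0" and bc: "p {1} + p {-1, 1} \<noteq> 0"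
    and \<kappa>: "x \<noteq> 0 \<or> p {-1} + p {-1, 1} * y^2 \<noteq> 0"
  defines "\<alpha> \<equiv> 4 * p {1} * (p {-1} + p {-1, 1} * y ^ 2)"
    and "\<beta> \<equiv> 4 * p {-1} * (p {1} + p {-1, 1})"
  defines "U \<equiv> sqrt1 (1 - fps_const \<alpha> * fps_X ^ 2)" and "V \<equiv> sqrt1 (1 - fps_const \<beta> * fps_X ^ 2)"
  obtains d A B C D where "d \<noteq> 0"
    and "fps_of_poly d * D_plus p x y
      = fps_of_poly A + fps_of_poly B * U + fps_of_poly C * V + fps_of_poly D * U * V"
    and "x^2 \<noteq> 1 \<Longrightarrow> D \<noteq> 0" and "x^2 \<noteq> -1 \<Longrightarrow> C \<noteq> 0"
    and "x^2 \<noteq> 1 \<Longrightarrow> \<alpha> + 4 * p {1}^2 * y^2 \<noteq> 0 \<Longrightarrow> B + D \<noteq> 0"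
    and "x = 0 \<Longrightarrow> B + C \<noteq> 0"
proof -
  \<comment> \<open>All scalars are lifted to constant polynomials and \<open>T\<close> is the
    polynomial \<open>t\<close>, so that the ring identities above can be read in the ring of
    polynomials in \<open>t\<close>.\<close>
  define T cx cy k c\<alpha> g where "T = [:0, 1 :: 'a:]" and "cx = [:x:]" and "cy = [:y:]"
    and "k = [:2 * p {1} * y:]" and "c\<alpha> = [:\<alpha>:]" and "g = [:0, 2 * (p {1} + p {-1, 1}):]"
  define u h where "u = 1 - c\<alpha> * T^2" and "h = k * T"
  define m r n l where "m = h^2 - 1 - u" and "r = h * cx - 1" and "n = h * cx + 1"
    and "l = g * (h * cy + cx * cy)"
  define e0 e1 where "e0 = r * m - 2 * u" and "e1 = m - 2 * r"
  define \<kappa>' where "\<kappa>' = [:x * y, - (p {-1} + p {1} * x^2 * y^2 + p {-1, 1} * y^2):]"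
  note defs = T_def cx_def cy_def k_def c\<alpha>_def g_def
  note fpoly = fps_of_poly_add fps_of_poly_diff fps_of_poly_mult fps_of_poly_power fps_of_poly_uminus
    fps_of_poly_numeral fps_of_poly_1 fps_of_poly_const
  have T: "fps_of_poly T = fps_X" by (simp add: T_def fps_of_poly_pCons)
  have U2: "U^2 = 1 - fps_const \<alpha> * fps_X ^ 2" unfolding U_def by (rule sqrt1_power2) simp
  then have U: "U * U = fps_of_poly u"
    unfolding u_def c\<alpha>_def fpoly T by (simp only: power2_eq_square)
  have X: "fps_of_poly h * X_fun p y = 1 - U"
    using X_fun_eq(1)[of p, OF b y] unfolding h_def k_def fpoly T U_def \<alpha>_def .
  have Y: "fps_of_poly g * Y_fun p = 1 - V"
    using Y_fun_eq(1)[of p, OF bc] by (simp add: g_def fps_of_poly_pCons V_def \<beta>_def mult_ac)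
  have \<kappa>'_eq: "fps_of_poly \<kappa>' = fps_const x * fps_const y - fps_X * (fps_const (p {-1})
      + fps_const (p {1}) * fps_const x^2 * fps_const y^2 + fps_const (p {-1, 1}) * fps_const y^2)"
    by (simp add: \<kappa>'_def fps_of_poly_pCons fps_const_power fps_const_neg[symmetric] del: fps_const_neg)
  have D: "fps_of_poly \<kappa>' * (1 - X_fun p y ^ 2) * D_plus p x y
      = (fps_of_poly cx - X_fun p y) * (fps_of_poly cy - fps_of_poly cx * Y_fun p
         - X_fun p y * Y_fun p + fps_of_poly cx * fps_of_poly cy * X_fun p y)"
    unfolding cx_def cy_def fps_of_poly_const \<kappa>'_eq
    by (rule D_plus_product_form[OF X_fun_eq(2)[of p, OF b y] Y_fun_eq(2)[of p, OF bc]])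
  note eq = biquadratic_form_aux[OF D X Y U]
  have eq': "fps_of_poly (\<kappa>' * g * (m^2 - 4 * u)) * D_plus p x y
    = fps_of_poly (e0 * (l - n) + e1 * (1 - g * cx * cy) * u)
      + fps_of_poly (e0 * (1 - g * cx * cy) + e1 * (l - n)) * U
      + fps_of_poly (e0 * n - e1 * u) * V + fps_of_poly (e1 * n - e0) * U * V"
    unfolding e0_def e1_def m_def r_def n_def l_def fpoly by (rule eq)
  note co = biquadratic_coefficients(1)[where t = T and k = k and \<alpha> = c\<alpha>]
    biquadratic_coefficients(2,3)[where t = T and k = k and \<alpha> = c\<alpha> and x = cx]
    biquadratic_coefficients(4,5)[where t = T and k = k and \<alpha> = c\<alpha> and x = cx and y = cy and g = g]
  note co = co[folded u_def h_def, folded m_def r_def n_def l_def, folded e0_def e1_def]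
  have T0: "T \<noteq> 0" by (simp add: T_def)
  have nz: "E \<noteq> 0" if "poly E 0 \<noteq> 0" for E :: "'a poly" using that by auto
  have d: "\<kappa>' * g * (m^2 - 4 * u) \<noteq> 0"
  proof -
    \<comment> \<open>For \<open>x \<noteq> 0\<close> the constant coefficient is nonzero; for
      \<open>x = 0\<close> the linear one is, by the assumption on the weights.\<close>
    have "\<kappa>' \<noteq> 0" using \<kappa> y by (auto simp: \<kappa>'_def neg_eq_iff_add_eq_0)
    moreover have "g \<noteq> 0" using bc by (simp add: g_def distrib_left[symmetric] del: distrib_left_numeral)
    moreover have "- 4 * k^2 + T^2 * (k^2 + c\<alpha>)^2 \<noteq> 0"
      using b y by (intro nz) (simp add: T_def k_def)
    ultimately show ?thesis unfolding co(1) using T0 by simp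
  qed
  show ?thesis
  proof (rule that[OF d eq'])
    assume x: "x^2 \<noteq> 1"
    have x': "1 - cx^2 \<noteq> 0" using x by (intro nz) (simp add: cx_def)
    have k0: "k \<noteq> 0" using b y by (simp add: k_def)
    show "e1 * n - e0 \<noteq> 0" unfolding co(2) using x' k0 T0 by simp
    assume "\<alpha> + 4 * p {1}^2 * y^2 \<noteq> 0"
    then have "c\<alpha> + k^2 \<noteq> 0" by (intro nz) (simp add: c\<alpha>_def k_def power_mult_distrib)
    moreover have "g \<noteq> 0" "cy \<noteq> 0" using bc y
      by (simp_all add: g_def cy_def distrib_left[symmetric] del: distrib_left_numeral)
    ultimately show "e0 * (1 - g * cx * cy) + e1 * (l - n) + (e1 * n - e0) \<noteq> 0"
      unfolding co(4) using x' k0 T0 by simp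
  next
    assume "x^2 \<noteq> -1"
    then have "x^2 + 1 \<noteq> 0" by (simp add: eq_neg_iff_add_eq_0)
    then have "- 2 * k^2 * (cx^2 + 1) + T^2 * ((k^2 + c\<alpha>) * (k^2 * cx^2 + c\<alpha>)) \<noteq> 0"
      using b y by (intro nz) (simp add: T_def k_def cx_def)
    then show "e0 * n - e1 * u \<noteq> 0" unfolding co(3) using T0 by simp
  next
    assume "x = 0"
    then have "cx = 0" by (simp add: cx_def)
    have "- 4 * k^2 + (k^2 + c\<alpha>) * (g * k * cy * T + c\<alpha> * T^2) \<noteq> 0"
      using b y by (intro nz) (simp add: T_def k_def)
    then show "e0 * (1 - g * cx * cy) + e1 * (l - n) + (e0 * n - e1 * u) \<noteq> 0"
      unfolding co(5)[OF \<open>cx = 0\<close>] using T0 by simp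
  qed
qed

text \<open>Without the fork \<open>Y = y X\<close>, and the second factor of the product form
  becomes \<open>y * (1 - X^2)\<close>, which cancels the denominator.\<close>

lemma D_plus_no_fork:
  fixes p :: "int set \<Rightarrow> 'a::field_char_0"
  assumes c: "p {-1, 1} = 0" and b: "p {1} \<noteq> 0" and y: "y \<noteq> 0"
  shows "(fps_const (x * y) - fps_X * fps_const (p {-1} + p {1} * x^2 * y^2)) * D_plus p x y
    = fps_const (x * y) - Y_fun p"
proof -
  define X where "X = X_fun p y"
  have bc: "p {1} + p {-1, 1} \<noteq> 0" using b c by simp
  have "fps_const (2 * p {1}) * fps_X * (fps_const y * X) = fps_const (2 * p {1} * y) * fps_X * X"
    by (simp only: fps_const_mult[symmetric] mult_ac)
  also have "\<dots> = fps_const (2 * p {1}) * fps_X * Y_fun p"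
    using X_fun_eq(1)[of p, OF b y] Y_fun_eq(1)[of p, OF bc] by (simp add: c X_def mult_ac)
  finally have Y: "Y_fun p = fps_const y * X" using b by simp
  have "X $ 0 = 0" using X_fun_eq(3)[of p, OF b y] by (simp add: X_def)
  then have "(1 - X^2) $ 0 = 1" by (simp add: power2_eq_square)
  then have X2: "1 - X^2 \<noteq> 0" by (metis fps_zero_nth zero_neq_one)
  have "(fps_const x * fps_const y - fps_X * (fps_const (p {-1}) + fps_const (p {1}) * fps_const x^2
      * fps_const y^2 + fps_const (p {-1, 1}) * fps_const y^2)) * (1 - X^2) * D_plus p x y
     = (fps_const x - X) * (fps_const y - fps_const x * Y_fun p - X * Y_fun p + fps_const x * fps_const y * X)"
    unfolding X_def by (rule D_plus_product_form[OF X_fun_eq(2)[of p, OF b y] Y_fun_eq(2)[of p, OF bc]])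
  also have "\<dots> = (1 - X^2) * (fps_const x * fps_const y - Y_fun p)"
    unfolding Y by (simp add: algebra_simps power2_eq_square)
  finally have "(1 - X^2) * ((fps_const x * fps_const y - fps_X * (fps_const (p {-1})
      + fps_const (p {1}) * fps_const x^2 * fps_const y^2)) * D_plus p x y)
      = (1 - X^2) * (fps_const x * fps_const y - Y_fun p)"
    by (simp add: c mult_ac)
  then have "(fps_const x * fps_const y - fps_X * (fps_const (p {-1})
      + fps_const (p {1}) * fps_const x^2 * fps_const y^2)) * D_plus p x y
      = fps_const x * fps_const y - Y_fun p"
    using X2 mult_left_cancel by blast
  then show ?thesis by (simp add: fps_const_power)
qed

section \<open>The degrees of the specialisations\<close>

lemma D_plus_no_up_step_degree:
  fixes p :: "int set \<Rightarrow> 'a::field_char_0"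
  assumes b: "p {1} = 0" and y: "y \<noteq> 0" and xs: "x \<noteq> 0 \<or> p {-1} + p {-1, 1} * y ^ 2 \<noteq> 0"
  shows "algebraic_fps (D_plus p x y)" "algebraic_degree (D_plus p x y) \<le> 2"
    and "p {-1} \<noteq> 0 \<Longrightarrow> p {-1, 1} \<noteq> 0 \<Longrightarrow> algebraic_degree (D_plus p x y) = 2"
proof -
  define s where "s = p {-1, 1} * y ^ 2 + p {-1}"
  define Y where "Y = fps_X * fps_const (p {-1}) * D_plus p 0 0"
  define V where "V = sqrt1 (1 - fps_const (4 * p {-1} * (p {1} + p {-1, 1})) * fps_X ^ 2)"
  have V: "V^2 = 1 - fps_const (4 * p {-1} * (p {1} + p {-1, 1})) * fps_X ^ 2"
    unfolding V_def by (rule sqrt1_power2) simp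
  obtain g A B where g: "g \<noteq> 0" and Y: "fps_of_poly g * Y = fps_of_poly A + fps_of_poly B * V"
    and B: "p {1} + p {-1, 1} \<noteq> 0 \<Longrightarrow> B \<noteq> 0"
    unfolding Y_def V_def by (rule fps_Y_quadratic[of p]) blast
  \<comment> \<open>Collecting the terms of \<open>D_plus_no_up_step\<close> that contain
    \<open>Y\<close> gives the coefficient \<open>-(x y + s t)\<close>, which is
    \<open>-e\<close>.\<close>
  define d e where "d = [:y^2, 0, -(s^2):]" and "e = [:x * y, s:]"
  have fd: "fps_of_poly d = fps_const (y^2) - fps_X^2 * fps_const (s^2)"
    by (simp add: d_def fps_of_poly_pCons power2_eq_square fps_const_neg[symmetric] algebra_simps
        del: fps_const_neg)
  have fe: "fps_of_poly e = fps_const (x * y) + fps_X * fps_const s"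
    by (simp add: e_def fps_of_poly_pCons)
  have "d \<noteq> 0" using y by (simp add: d_def)
  then have gd: "g * d \<noteq> 0" using g by simp
  have e: "e \<noteq> 0" using xs y by (auto simp: e_def s_def add.commute)
  have "fps_of_poly d * D_plus p x y = fps_const (y^2) + fps_X * fps_const s * fps_const (x * y) - fps_of_poly e * Y"
    unfolding fd fe using D_plus_no_up_step[OF b y xs] unfolding s_def[symmetric] Y_def[symmetric]
    by (simp add: algebra_simps)
  also have "\<dots> = fps_of_poly [:y^2, s * (x * y):] - fps_of_poly e * Y"
    by (simp add: fps_of_poly_pCons mult.assoc)
  finally have "fps_of_poly (g * d) * D_plus p x y
      = fps_of_poly (g * [:y^2, s * (x * y):]) - fps_of_poly e * (fps_of_poly g * Y)"
    unfolding fps_of_poly_mult mult.assoc by (simp only: right_diff_distrib mult.left_commute)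
  then have eq: "fps_of_poly (g * d) * D_plus p x y
      = fps_of_poly (g * [:y^2, s * (x * y):] - e * A) + fps_of_poly (- (e * B)) * V"
    unfolding Y by (simp only: fps_of_poly_diff fps_of_poly_mult fps_of_poly_uminus) (simp add: algebra_simps)
  show "algebraic_fps (D_plus p x y)" "algebraic_degree (D_plus p x y) \<le> 2"
    using quadratic_degree_le_2[OF V gd eq] by auto
  assume "p {-1} \<noteq> 0" "p {-1, 1} \<noteq> 0"
  then show "algebraic_degree (D_plus p x y) = 2"
    using b B e by (intro quadratic_degree_2[OF V _ gd eq]) auto
qed

lemma D_plus_at_1_degree:
  fixes p :: "int set \<Rightarrow> 'a::field_char_0"
  assumes y: "y \<noteq> 0"
  shows "algebraic_fps (D_plus p 1 y)" "algebraic_degree (D_plus p 1 y) \<le> 2"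
    and "p {-1} \<noteq> 0 \<Longrightarrow> p {1} + p {-1, 1} \<noteq> 0 \<Longrightarrow> algebraic_degree (D_plus p 1 y) = 2"
proof -
  define Y where "Y = fps_X * fps_const (p {-1}) * D_plus p 0 0"
  define V where "V = sqrt1 (1 - fps_const (4 * p {-1} * (p {1} + p {-1, 1})) * fps_X ^ 2)"
  have V: "V^2 = 1 - fps_const (4 * p {-1} * (p {1} + p {-1, 1})) * fps_X ^ 2"
    unfolding V_def by (rule sqrt1_power2) simp
  obtain g A B where g: "g \<noteq> 0" and Y: "fps_of_poly g * Y = fps_of_poly A + fps_of_poly B * V"
    and B: "p {1} + p {-1, 1} \<noteq> 0 \<Longrightarrow> B \<noteq> 0"
    unfolding Y_def V_def by (rule fps_Y_quadratic[of p]) blast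
  define d where "d = [:y, - (p {-1} + (p {1} + p {-1, 1}) * y^2):]"
  have fd: "fps_of_poly d = fps_const y - fps_X * (fps_const (p {-1})
      + (fps_const (p {1}) + fps_const (p {-1, 1})) * fps_const y^2)"
    by (simp add: d_def fps_of_poly_pCons fps_const_power fps_const_neg[symmetric] del: fps_const_neg)
  have "d \<noteq> 0" using y by (simp add: d_def)
  then have gd: "g * d \<noteq> 0" using g by simp
  have "fps_of_poly d * D_plus p 1 y = fps_const y - Y"
    unfolding fd Y_def by (rule D_plus_at_1)
  then have "fps_of_poly (g * d) * D_plus p 1 y = fps_of_poly g * fps_const y - fps_of_poly g * Y"
    unfolding fps_of_poly_mult mult.assoc by (simp only: right_diff_distrib)
  then have eq: "fps_of_poly (g * d) * D_plus p 1 y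
      = fps_of_poly (g * [:y:] - A) + fps_of_poly (- B) * V"
    unfolding Y by (simp only: fps_of_poly_diff fps_of_poly_mult fps_of_poly_uminus fps_of_poly_const)
      (simp add: algebra_simps)
  show "algebraic_fps (D_plus p 1 y)" "algebraic_degree (D_plus p 1 y) \<le> 2"
    using quadratic_degree_le_2[OF V gd eq] by auto
  assume "p {-1} \<noteq> 0" "p {1} + p {-1, 1} \<noteq> 0"
  then show "algebraic_degree (D_plus p 1 y) = 2"
    using B by (intro quadratic_degree_2[OF V _ gd eq]) auto
qed

lemma one_degree: "algebraic_fps (1 :: 'a::field_char_0 fps)" "algebraic_degree (1 :: 'a fps) \<le> 2"
  using quadratic_degree_le_2[of 1 0 1 "1 :: 'a fps" 1 0] by simp_all

lemma D_plus_0_0_degree: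
  fixes p :: "int set \<Rightarrow> 'a::field_char_0"
  shows "algebraic_fps (D_plus p 0 0)" "algebraic_degree (D_plus p 0 0) \<le> 2"
    and "p {-1} \<noteq> 0 \<Longrightarrow> p {1} + p {-1, 1} \<noteq> 0 \<Longrightarrow> algebraic_degree (D_plus p 0 0) = 2"
proof -
  define V where "V = sqrt1 (1 - fps_const (4 * p {-1} * (p {1} + p {-1, 1})) * fps_X ^ 2)"
  have V: "V^2 = 1 - fps_const (4 * p {-1} * (p {1} + p {-1, 1})) * fps_X ^ 2"
    unfolding V_def by (rule sqrt1_power2) simp
  obtain g A B where g: "g \<noteq> 0"
    and Y: "fps_of_poly g * (fps_X * fps_const (p {-1}) * D_plus p 0 0) = fps_of_poly A + fps_of_poly B * V"
    and B: "p {1} + p {-1, 1} \<noteq> 0 \<Longrightarrow> B \<noteq> 0"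
    unfolding V_def by (rule fps_Y_quadratic[of p]) blast
  have "fps_of_poly [:0, p {-1}:] = fps_X * fps_const (p {-1})" by (simp add: fps_of_poly_pCons)
  then have eq: "fps_of_poly (g * [:0, p {-1}:]) * D_plus p 0 0 = fps_of_poly A + fps_of_poly B * V"
    unfolding Y[symmetric] fps_of_poly_mult by (simp only: mult.assoc)
  have gd: "g * [:0, p {-1}:] \<noteq> 0" if "p {-1} \<noteq> 0" using that g by simp
  have "algebraic_fps (D_plus p 0 0) \<and> algebraic_degree (D_plus p 0 0) \<le> 2"
  \<comment> \<open>For \<open>p {-1} = 0\<close> the factor in front of the series vanishes, but
    then the series is 1.\<close>
  proof (cases "p {-1} = 0")
    case True
    then show ?thesis using one_degree by (simp add: D_plus_0_0_eq_1[of p])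
  next
    case False
    show ?thesis by (rule quadratic_degree_le_2[OF V gd[OF False] eq])
  qed
  then show "algebraic_fps (D_plus p 0 0)" "algebraic_degree (D_plus p 0 0) \<le> 2" by auto
  assume "p {-1} \<noteq> 0" "p {1} + p {-1, 1} \<noteq> 0"
  then show "algebraic_degree (D_plus p 0 0) = 2"
    using B by (intro quadratic_degree_2[OF V _ gd eq]) auto
qed

text \<open>In general both square roots contribute. They coincide for
  \<open>\<alpha> = \<beta>\<close>, and \<open>p {-1} = 0\<close> gives \<open>\<beta> = 0\<close>
  and hence \<open>V = 1\<close>; either way one root is left. The conditions on \<open>x^2\<close>
  keep the needed coefficients nonzero.\<close>

lemma D_plus_up_step_degree:
  fixes p :: "int set \<Rightarrow> 'a::field_char_0"
  assumes b: "p {1} \<noteq> 0" and y: "y \<noteq> 0" and bc: "p {1} + p {-1, 1} \<noteq> 0"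
    and xs: "x \<noteq> 0 \<or> p {-1} + p {-1, 1} * y ^ 2 \<noteq> 0"
  defines "\<alpha> \<equiv> 4 * p {1} * (p {-1} + p {-1, 1} * y ^ 2)"
    and "\<beta> \<equiv> 4 * p {-1} * (p {1} + p {-1, 1})"
  shows "algebraic_fps (D_plus p x y)" "algebraic_degree (D_plus p x y) \<le> 4"
    and "\<alpha> \<noteq> 0 \<Longrightarrow> \<beta> \<noteq> 0 \<Longrightarrow> \<alpha> \<noteq> \<beta> \<Longrightarrow> x^2 \<noteq> 1 \<Longrightarrow> x^2 \<noteq> -1 \<Longrightarrow> algebraic_degree (D_plus p x y) = 4"
    and "\<alpha> = \<beta> \<Longrightarrow> algebraic_degree (D_plus p x y) \<le> 2"
    and "\<alpha> = \<beta> \<Longrightarrow> \<alpha> \<noteq> 0 \<Longrightarrow> x = 0 \<Longrightarrow> algebraic_degree (D_plus p x y) = 2"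
    and "p {-1} = 0 \<Longrightarrow> algebraic_degree (D_plus p x y) \<le> 2"
    and "p {-1} = 0 \<Longrightarrow> p {-1, 1} \<noteq> 0 \<Longrightarrow> x^2 \<noteq> 1 \<Longrightarrow> algebraic_degree (D_plus p x y) = 2"
proof -
  define U V where "U = sqrt1 (1 - fps_const \<alpha> * fps_X ^ 2)" and "V = sqrt1 (1 - fps_const \<beta> * fps_X ^ 2)"
  have U: "U^2 = 1 - fps_const \<alpha> * fps_X ^ 2" and V: "V^2 = 1 - fps_const \<beta> * fps_X ^ 2"
    unfolding U_def V_def by (rule sqrt1_power2; simp)+
  obtain d A B C D where d: "d \<noteq> 0"
    and eq: "fps_of_poly d * D_plus p x y
      = fps_of_poly A + fps_of_poly B * U + fps_of_poly C * V + fps_of_poly D * U * V"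
    and nz: "x^2 \<noteq> 1 \<Longrightarrow> D \<noteq> 0" "x^2 \<noteq> -1 \<Longrightarrow> C \<noteq> 0"
      "x^2 \<noteq> 1 \<Longrightarrow> \<alpha> + 4 * p {1}^2 * y^2 \<noteq> 0 \<Longrightarrow> B + D \<noteq> 0"
      "x = 0 \<Longrightarrow> B + C \<noteq> 0"
    unfolding U_def V_def \<alpha>_def \<beta>_def by (rule D_plus_biquadratic[OF b y bc xs]) blast
  show "algebraic_fps (D_plus p x y)" "algebraic_degree (D_plus p x y) \<le> 4"
    using biquadratic_degree_le_4[OF U V d eq] by auto
  show "algebraic_degree (D_plus p x y) = 4"
    if "\<alpha> \<noteq> 0" "\<beta> \<noteq> 0" "\<alpha> \<noteq> \<beta>" "x^2 \<noteq> 1" "x^2 \<noteq> -1"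
    by (rule biquadratic_degree_4[OF U V that(1-3) d eq nz(2)[OF that(5)] nz(1)[OF that(4)]])
  have eq1: "fps_of_poly d * D_plus p x y
      = fps_of_poly (A + D * [:1, 0, -\<alpha>:]) + fps_of_poly (B + C) * U" if "\<alpha> = \<beta>"
  proof -
    have "V = U" unfolding U_def V_def that ..
    then have "fps_of_poly d * D_plus p x y
      = fps_of_poly A + fps_of_poly D * U^2 + (fps_of_poly B + fps_of_poly C) * U"
      unfolding eq by (simp add: algebra_simps power2_eq_square)
    then show ?thesis
      unfolding U fps_of_poly_add fps_of_poly_mult fps_of_poly_1_minus power2_eq_square[of fps_X] .
  qed
  show "algebraic_degree (D_plus p x y) \<le> 2" if "\<alpha> = \<beta>"
    using quadratic_degree_le_2[OF U d eq1[OF that]] by simp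
  show "algebraic_degree (D_plus p x y) = 2" if "\<alpha> = \<beta>" "\<alpha> \<noteq> 0" "x = 0"
    by (rule quadratic_degree_2[OF U that(2) d eq1[OF that(1)] nz(4)[OF that(3)]])
  have eq2: "fps_of_poly d * D_plus p x y = fps_of_poly (A + C) + fps_of_poly (B + D) * U" if "p {-1} = 0"
  proof -
    have "V^2 = 1" "V $ 0 = 1" using that sqrt1_nth_0[of 1] unfolding V by (simp_all add: \<beta>_def V_def)
    \<comment> \<open>The constant term 1 excludes the root \<open>V = -1\<close>.\<close>
    then have "V = 1" by (auto simp: power2_eq_1_iff)
    then show ?thesis unfolding eq by (simp add: fps_of_poly_add algebra_simps)
  qed
  show "algebraic_degree (D_plus p x y) \<le> 2" if "p {-1} = 0"
    using quadratic_degree_le_2[OF U d eq2[OF that]] by simp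
  show "algebraic_degree (D_plus p x y) = 2" if "p {-1} = 0" "p {-1, 1} \<noteq> 0" "x^2 \<noteq> 1"
  proof (rule quadratic_degree_2[OF U _ d eq2[OF that(1)] nz(3)[OF that(3)]])
    show "\<alpha> \<noteq> 0" using that b y by (simp add: \<alpha>_def)
    have "\<alpha> + 4 * p {1}^2 * y^2 = 4 * p {1} * y^2 * (p {1} + p {-1, 1})"
      using that(1) by (simp add: \<alpha>_def algebra_simps power2_eq_square)
    then show "\<alpha> + 4 * p {1}^2 * y^2 \<noteq> 0" using b y bc by simp
  qed
qed

text \<open>Here \<open>\<alpha> = \<beta>\<close>, where \<open>D_plus_up_step_degree\<close> gives
  the exact degree only at \<open>x = 0\<close>. The simpler closed form shows the coefficient of
  \<open>V\<close> to be 1.\<close>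

lemma D_plus_no_fork_degree:
  fixes p :: "int set \<Rightarrow> 'a::field_char_0"
  assumes c: "p {-1, 1} = 0" and b: "p {1} \<noteq> 0" and a: "p {-1} \<noteq> 0" and x: "x \<noteq> 0" and y: "y \<noteq> 0"
  shows "algebraic_degree (D_plus p x y) = 2"
proof -
  define V where "V = sqrt1 (1 - fps_const (4 * p {-1} * (p {1} + p {-1, 1})) * fps_X ^ 2)"
  have V: "V^2 = 1 - fps_const (4 * p {-1} * (p {1} + p {-1, 1})) * fps_X ^ 2"
    unfolding V_def by (rule sqrt1_power2) simp
  have bc: "p {1} + p {-1, 1} \<noteq> 0" using b c by simp
  define g d where "g = [:0, 2 * p {1}:]" and "d = [:x * y, - (p {-1} + p {1} * x^2 * y^2):]"
  have fg: "fps_of_poly g = fps_const (2 * p {1}) * fps_X"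
    by (simp add: g_def fps_of_poly_pCons mult.commute)
  have fd: "fps_of_poly d = fps_const (x * y) - fps_X * fps_const (p {-1} + p {1} * x^2 * y^2)"
    by (simp add: d_def fps_of_poly_pCons fps_const_neg[symmetric] del: fps_const_neg)
  have Y: "fps_of_poly g * Y_fun p = 1 - V"
    using Y_fun_eq(1)[of p, OF bc] c by (simp add: fg V_def)
  have "g \<noteq> 0" "d \<noteq> 0" using b x y by (simp_all add: g_def d_def)
  then have gd: "g * d \<noteq> 0" by simp
  have "fps_of_poly (g * d) * D_plus p x y = fps_of_poly g * (fps_of_poly d * D_plus p x y)"
    by (simp only: fps_of_poly_mult mult.assoc)
  also have "\<dots> = fps_of_poly g * fps_const (x * y) - fps_of_poly g * Y_fun p"
    unfolding fd D_plus_no_fork[of p, OF c b y] by (rule right_diff_distrib)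
  finally have eq: "fps_of_poly (g * d) * D_plus p x y
      = fps_of_poly (g * [:x * y:] - 1) + fps_of_poly 1 * V"
    unfolding Y by (simp only: fps_of_poly_diff fps_of_poly_mult fps_of_poly_const fps_of_poly_1)
      (simp add: algebra_simps)
  show ?thesis by (rule quadratic_degree_2[OF V _ gd eq]) (use a bc in auto)
qed

section \<open>Weights and indeterminates in the rational function fields\<close>

lemma const2_eq_0_iff [simp]: "const2 r = 0 \<longleftrightarrow> r = 0"
  and const1_eq_0_iff [simp]: "const1 r = 0 \<longleftrightarrow> r = 0"
  and const2_0 [simp]: "const2 0 = 0"
  and const2_add: "const2 (r + s) = const2 r + const2 s"
  and const1_add: "const1 (r + s) = const1 r + const1 s"
  by (simp_all add: const2_def const1_def flip: to_fract_add)

lemma var2_nonzero: "var2_x \<noteq> 0" "var2_y \<noteq> 0" "var2_x ^ 2 \<noteq> 1" "var2_x ^ 2 \<noteq> -1"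
proof -
  have square: "var2_x ^ 2 = to_fract [:0, 0, 1:]"
    by (simp add: var2_x_def power2_eq_square flip: to_fract_mult)
  have "[:1:] = (1 :: real poly poly)" "[:-1:] = (-1 :: real poly poly)"
    by (simp_all add: one_pCons)
  then have one: "1 = to_fract [:1 :: real poly:]" "-1 = to_fract [:-1 :: real poly:]"
    by (simp_all only: to_fract_1 to_fract_uminus)
  show "var2_x ^ 2 \<noteq> 1" unfolding square one(1) to_fract_eq_iff by simp
  show "var2_x ^ 2 \<noteq> -1" unfolding square one(2) to_fract_eq_iff by simp
qed (simp_all add: var2_x_def var2_y_def)

text \<open>Since \<open>y\<close> is an indeterminate, coefficients can be compared. With the
  weights inserted, the second equation is \<open>\<alpha> = \<beta>\<close> up to the factor
  4.\<close>

lemma const2_var2_y: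
  "const2 a + const2 c * var2_y ^ 2 = 0 \<longleftrightarrow> a = 0 \<and> c = 0"
  "const2 b * (const2 a + const2 c * var2_y ^ 2) = const2 a * (const2 b + const2 c)
    \<longleftrightarrow> b * c = 0 \<and> a * c = 0"
  by (simp_all add: const2_def var2_y_def power2_eq_square flip: to_fract_add to_fract_mult)
    (auto simp: algebra_simps)

section \<open>The closed formulas as quotients of power series\<close>

lemma fps_divide_eq_of_mult:
  fixes f g h :: "'a::field fps"
  assumes "h * g = f" "g \<noteq> 0"
  shows "h = f / g"
  using assms by auto

text \<open>Nonzero constant terms make \<open>A\<close> and \<open>C\<close> units, so both
  divisions are exact and the quotient may be split into two factors.\<close>

lemma product_form_divide:
  fixes D :: "'a::field fps"
  assumes "C * A * D = M * N" "A $ 0 \<noteq> 0" "C $ 0 \<noteq> 0"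
  shows "D = M / A * (N / C)"
proof -
  have AC: "C * A \<noteq> 0" using assms(2,3) by auto
  have "A dvd M" "C dvd N" using assms(2,3) by (simp_all add: fps_is_unit_iff unit_imp_dvd)
  then have "A * (M / A) = M" "C * (N / C) = N" by simp_all
  moreover have "(C * A) * (M / A * (N / C)) = (A * (M / A)) * (C * (N / C))"
    by (simp only: mult_ac)
  ultimately have "(C * A) * D = (C * A) * (M / A * (N / C))"
    by (simp only: assms(1))
  with AC show ?thesis by (rule mult_left_cancel[THEN iffD1])
qed

lemma D_plus_formula_up_step:
  fixes p :: "int set \<Rightarrow> 'a::field_char_0"
  assumes b: "p {1} \<noteq> 0" and x: "x \<noteq> 0" and y: "y \<noteq> 0" and bc: "p {1} + p {-1, 1} \<noteq> 0"
  shows "D_plus p x y = (fps_const x - X_fun p y) / (1 - X_fun p y ^ 2)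
    * ((fps_const y - fps_const x * Y_fun p - X_fun p y * Y_fun p + fps_const (x * y) * X_fun p y)
       / (fps_const (x * y) * (1 - fps_X * fps_const (step_poly p x y))))"
proof (rule product_form_divide)
  have "x * y * step_poly p x y = p {-1} + p {1} * x^2 * y^2 + p {-1, 1} * y^2"
    using x y by (simp add: step_poly_def field_simps power2_eq_square)
  then have eq: "fps_const (x * y) * (1 - fps_X * fps_const (step_poly p x y))
      = fps_const x * fps_const y - fps_X * (fps_const (p {-1})
        + fps_const (p {1}) * fps_const x^2 * fps_const y^2 + fps_const (p {-1, 1}) * fps_const y^2)"
    by (simp add: right_diff_distrib fps_const_power mult.left_commute[of _ fps_X])
  show "fps_const (x * y) * (1 - fps_X * fps_const (step_poly p x y)) * (1 - X_fun p y ^ 2) * D_plus p x y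
    = (fps_const x - X_fun p y) * (fps_const y - fps_const x * Y_fun p - X_fun p y * Y_fun p
        + fps_const (x * y) * X_fun p y)"
    unfolding eq unfolding fps_const_mult[of x y, symmetric]
    by (rule D_plus_product_form[OF X_fun_eq(2)[of p, OF b y] Y_fun_eq(2)[of p, OF bc]])
  show "(1 - X_fun p y ^ 2) $ 0 \<noteq> 0"
    using X_fun_eq(3)[of p, OF b y] by (simp add: power2_eq_square)
  show "(fps_const (x * y) * (1 - fps_X * fps_const (step_poly p x y))) $ 0 \<noteq> 0"
    using x y by simp
qed

lemma D_plus_formula_no_up_step:
  fixes p :: "int set \<Rightarrow> 'a::field_char_0"
  assumes b: "p {1} = 0" and x: "x \<noteq> 0" and y: "y \<noteq> 0" and c: "p {-1, 1} \<noteq> 0"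
  shows "D_plus p x y = (fps_const (y ^ 2) - fps_const (x * y) * Y_fun p
      - fps_X * fps_const (p {-1, 1} * y ^ 2 + p {-1}) * (Y_fun p - fps_const (x * y)))
    / (fps_const (y ^ 2) - fps_X ^ 2 * fps_const ((p {-1, 1} * y ^ 2 + p {-1}) ^ 2))"
proof (rule fps_divide_eq_of_mult)
  have bc: "p {1} + p {-1, 1} \<noteq> 0" using b c by simp
  show "D_plus p x y * (fps_const (y ^ 2) - fps_X ^ 2 * fps_const ((p {-1, 1} * y ^ 2 + p {-1}) ^ 2))
    = fps_const (y ^ 2) - fps_const (x * y) * Y_fun p
      - fps_X * fps_const (p {-1, 1} * y ^ 2 + p {-1}) * (Y_fun p - fps_const (x * y))"
    unfolding Y_fun_eq(2)[of p, OF bc]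
      D_plus_no_up_step[where p = p and x = x and y = y, OF b y disjI1[OF x], symmetric]
    by (rule mult.commute)
  have "(fps_const (y ^ 2) - fps_X ^ 2 * fps_const ((p {-1, 1} * y ^ 2 + p {-1}) ^ 2)) $ 0 = y^2"
    by (simp add: power2_eq_square)
  then show "fps_const (y ^ 2) - fps_X ^ 2 * fps_const ((p {-1, 1} * y ^ 2 + p {-1}) ^ 2) \<noteq> 0"
    using y by (metis fps_zero_nth power_not_zero)
qed

lemma dyck_steps_distinct: "{-1} \<noteq> {1 :: int}" "{-1} \<noteq> {-1, 1 :: int}" "{1} \<noteq> {-1, 1 :: int}"
  by auto

section \<open>Case distinctions on nonnegative weights\<close>

lemma D_plus_generic_degree:
  fixes p :: "int set \<Rightarrow> real"
  defines "D \<equiv> D_plus (\<lambda>s. const2 (p s)) var2_x var2_y"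
  assumes nonneg: "p {-1} \<ge> 0" "p {1} \<ge> 0" "p {-1, 1} \<ge> 0"
  shows "algebraic_fps D"
    and "\<forall>s\<in>dyck_steps. p s > 0 \<Longrightarrow> algebraic_degree D = 4"
    and "\<exists>s\<in>dyck_steps. p s = 0 \<Longrightarrow> algebraic_degree D \<le> 2"
    and "\<exists>!s. s \<in> dyck_steps \<and> p s = 0 \<Longrightarrow> algebraic_degree D = 2"
proof -
  let ?q = "\<lambda>s. const2 (p s)"
  note down = D_plus_no_up_step_degree[of ?q, OF _ var2_nonzero(2) disjI1[OF var2_nonzero(1)], folded D_def]
  \<comment> \<open>Nonnegativity excludes cancellation between the two weights.\<close>
  have bc: "?q {1} + ?q {-1, 1} \<noteq> 0" if "p {1} \<noteq> 0"
    using that nonneg by (simp flip: const2_add)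
  note up = D_plus_up_step_degree[of ?q, OF _ var2_nonzero(2) bc disjI1[OF var2_nonzero(1)], folded D_def]
  note nofork = D_plus_no_fork_degree[of ?q, OF _ _ _ var2_nonzero(1,2), folded D_def]
  show "algebraic_fps D" using down(1) up(1) by (cases "p {1} = 0") auto
  show "algebraic_degree D = 4" if "\<forall>s\<in>dyck_steps. p s > 0"
  proof -
    have pos: "p {-1} > 0" "p {1} > 0" "p {-1, 1} > 0" using that by (auto simp: dyck_steps_def)
    have "const2 (p {1}) * (const2 (p {-1}) + const2 (p {-1, 1}) * var2_y ^ 2)
        \<noteq> const2 (p {-1}) * (const2 (p {1}) + const2 (p {-1, 1}))"
      unfolding const2_var2_y(2) using pos by simp
    then show ?thesis
      using pos bc by (intro up(3) var2_nonzero) (simp_all add: const2_var2_y(1) mult.assoc)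
  qed
  show le: "algebraic_degree D \<le> 2" if "\<exists>s\<in>dyck_steps. p s = 0"
  proof (cases "p {1} = 0")
    case True
    then show ?thesis using down(2) by simp
  next
    case False
    with that consider "p {-1} = 0" | "p {-1, 1} = 0" by (auto simp: dyck_steps_def)
    then show ?thesis
      \<comment> \<open>A missing step \<open>{-1}\<close> means \<open>V = 1\<close>, and a missing
        fork means \<open>\<alpha> = \<beta>\<close>.\<close>
      using False up(4,6) by cases (simp_all add: mult_ac)
  qed
  show "algebraic_degree D = 2" if ex: "\<exists>!s. s \<in> dyck_steps \<and> p s = 0"
  proof -
    have uniq: "s = s'" if "s \<in> dyck_steps" "p s = 0" "s' \<in> dyck_steps" "p s' = 0" for s s'
      using ex that by blast
    have mem: "{-1} \<in> dyck_steps" "{1} \<in> dyck_steps" "{-1, 1} \<in> dyck_steps"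
      by (simp_all add: dyck_steps_def)
    from ex consider "p {-1} = 0" | "p {1} = 0" | "p {-1, 1} = 0" by (auto simp: dyck_steps_def)
    then show ?thesis
    proof cases
      case 1
      then have "p {1} \<noteq> 0" "p {-1, 1} \<noteq> 0" using uniq mem dyck_steps_distinct by metis+
      with 1 show ?thesis using up(7) var2_nonzero(3) by simp
    next
      case 2
      then have "p {-1} \<noteq> 0" "p {-1, 1} \<noteq> 0" using uniq mem dyck_steps_distinct by metis+
      with 2 show ?thesis using down(3) by simp
    next
      case 3
      then have "p {-1} \<noteq> 0" "p {1} \<noteq> 0" using uniq mem dyck_steps_distinct by metis+
      with 3 show ?thesis using nofork by simp
    qed
  qed
qed

lemma D_plus_0_1_degree:
  fixes p :: "int set \<Rightarrow> real"
  defines "D \<equiv> D_plus p 0 1"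
  assumes nonneg: "p {-1} \<ge> 0" "p {1} \<ge> 0" "p {-1, 1} \<ge> 0"
  shows "algebraic_fps D" "algebraic_degree D \<le> 4"
    and "\<forall>s\<in>dyck_steps. p s > 0 \<Longrightarrow> p {1} \<noteq> p {-1} \<Longrightarrow> algebraic_degree D = 4"
    and "p {1} = p {-1} \<Longrightarrow> algebraic_degree D \<le> 2"
    and "p {1} = p {-1} \<Longrightarrow> p {1} > 0 \<Longrightarrow> algebraic_degree D = 2"
proof -
  \<comment> \<open>By nonnegativity both weights vanish. This case is treated apart because the
    cleared denominator would be 0 at \<open>x = 0\<close>.\<close>
  have ac: "D = 1" if "p {-1} + p {-1, 1} = 0"
    using that nonneg D_plus_0_eq_1[of p 1] by (simp add: D_def add_nonneg_eq_0_iff)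
  have bc: "p {1} + p {-1, 1} \<noteq> 0" if "p {1} \<noteq> 0"
    using that nonneg by linarith
  have ac': "(0::real) \<noteq> 0 \<or> p {-1} + p {-1, 1} * 1^2 \<noteq> 0" if "p {-1} + p {-1, 1} \<noteq> 0"
    using that by simp
  note down = D_plus_no_up_step_degree[of p, OF _ one_neq_zero ac', folded D_def]
  note up = D_plus_up_step_degree[of p, OF _ one_neq_zero bc ac', folded D_def]
  have "algebraic_fps D \<and> algebraic_degree D \<le> 4"
  proof (cases "p {-1} + p {-1, 1} = 0")
    case True
    then show ?thesis
      unfolding ac[OF True] using one_degree[where 'a = real] by auto
  next
    case False
    then show ?thesis using up(1,2) down(1,2) by (cases "p {1} = 0") fastforce+
  qed
  then show "algebraic_fps D" "algebraic_degree D \<le> 4" by auto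
  show "algebraic_degree D = 4" if "\<forall>s\<in>dyck_steps. p s > 0" "p {1} \<noteq> p {-1}"
  proof -
    have pos: "p {-1} > 0" "p {1} > 0" "p {-1, 1} > 0" using that(1) by (auto simp: dyck_steps_def)
    \<comment> \<open>Up to the factor 4 this is \<open>\<alpha> - \<beta>\<close> at
      \<open>y = 1\<close>; it explains why \<open>p {1} = p {-1}\<close> is the exceptional
      case.\<close>
    have "p {1} * (p {-1} + p {-1, 1}) - p {-1} * (p {1} + p {-1, 1}) = (p {1} - p {-1}) * p {-1, 1}"
      by (simp add: algebra_simps)
    then have "p {1} * (p {-1} + p {-1, 1}) \<noteq> p {-1} * (p {1} + p {-1, 1})"
      using pos that(2) by auto
    then show ?thesis using pos by (intro up(3)) auto
  qed
  show "algebraic_degree D \<le> 2" if "p {1} = p {-1}"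
  proof (cases "p {-1} + p {-1, 1} = 0")
    case True
    then show ?thesis using one_degree[where 'a = real] ac by simp
  next
    case False
    then show ?thesis using that up(4) down(2) by (cases "p {1} = 0") simp_all
  qed
  show "algebraic_degree D = 2" if "p {1} = p {-1}" "p {1} > 0"
    using that nonneg by (intro up(5)) auto
qed

text \<open>With two vanishing weights the series is rational, so a vanishing weight gives only the
  bound 2, and equality is claimed when exactly one vanishes. In the second formula
  \<open>p {-1, 1} > 0\<close> keeps the denominator of \<open>Y\<close> nonzero.\<close>

theorem theorem2p7:
  fixes p :: "int set \<Rightarrow> real"
    and q :: "int set \<Rightarrow> real poly poly fract"
    and x y :: "real poly poly fract"
    and X Y :: "real poly poly fract fps"
    and D :: "real poly poly fract fps"
    and D1 :: "real poly fract fps"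
  defines "q \<equiv> \<lambda>s. const2 (p s)"
    and "x \<equiv> var2_x"
    and "y \<equiv> var2_y"
    and "X \<equiv> X_fun q y"
    and "Y \<equiv> Y_fun q"
    and "D \<equiv> D_plus q x y"
    and "D1 \<equiv> D_plus (\<lambda>s. const1 (p s)) 1 var1_y"
  assumes nonneg: "p {-1} \<ge> 0" "p {1} \<ge> 0" "p {-1, 1} \<ge> 0"
  shows
    "(algebraic_fps D
      \<and> ((\<forall>s \<in> dyck_steps. p s > 0) \<longrightarrow> algebraic_degree D = 4)
      \<and> ((\<exists>s \<in> dyck_steps. p s = 0) \<longrightarrow> algebraic_degree D \<le> 2)
      \<and> ((\<exists>!s. s \<in> dyck_steps \<and> p s = 0) \<longrightarrow> algebraic_degree D = 2))
   \<and> (p {1} > 0 \<longrightarrow>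
        D = (fps_const x - X) / (1 - X ^ 2)
          * ((fps_const y - fps_const x * Y - X * Y + fps_const (x * y) * X)
             / (fps_const (x * y) * (1 - fps_X * fps_const (step_poly q x y)))))
   \<and> (p {1} = 0 \<and> p {-1, 1} > 0 \<longrightarrow>
        D = (fps_const (y ^ 2) - fps_const (x * y) * Y
              - fps_X * fps_const (q {-1, 1} * y ^ 2 + q {-1}) * (Y - fps_const (x * y)))
          / (fps_const (y ^ 2) - fps_X ^ 2 * fps_const ((q {-1, 1} * y ^ 2 + q {-1}) ^ 2)))
   \<and> (algebraic_fps D1 \<and> algebraic_degree D1 \<le> 2
      \<and> (p {-1} > 0 \<and> p {1} + p {-1, 1} > 0 \<longrightarrow> algebraic_degree D1 = 2))
   \<and> (algebraic_fps (D_plus p 0 0) \<and> algebraic_degree (D_plus p 0 0) \<le> 2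
      \<and> (p {-1} > 0 \<and> p {1} + p {-1, 1} > 0 \<longrightarrow> algebraic_degree (D_plus p 0 0) = 2))
   \<and> (D_plus p 0 1 = excursion_gf p
      \<and> algebraic_fps (D_plus p 0 1) \<and> algebraic_degree (D_plus p 0 1) \<le> 4
      \<and> ((\<forall>s \<in> dyck_steps. p s > 0) \<and> p {1} \<noteq> p {-1} \<longrightarrow> algebraic_degree (D_plus p 0 1) = 4)
      \<and> (p {1} = p {-1} \<longrightarrow> algebraic_degree (D_plus p 0 1) \<le> 2)
      \<and> (p {1} = p {-1} \<and> p {1} > 0 \<longrightarrow> algebraic_degree (D_plus p 0 1) = 2))"
proof -
  have bc: "q {1} + q {-1, 1} \<noteq> 0" if "p {1} > 0"
    using that nonneg by (simp add: q_def flip: const2_add)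
  have y1: "var1_y \<noteq> 0" by (simp add: var1_y_def)
  have formula1: "D = (fps_const x - X) / (1 - X ^ 2)
          * ((fps_const y - fps_const x * Y - X * Y + fps_const (x * y) * X)
             / (fps_const (x * y) * (1 - fps_X * fps_const (step_poly q x y))))" if "p {1} > 0"
    unfolding D_def X_def Y_def x_def y_def
    using that by (intro D_plus_formula_up_step bc var2_nonzero) (simp add: q_def)
  have formula2: "D = (fps_const (y ^ 2) - fps_const (x * y) * Y
              - fps_X * fps_const (q {-1, 1} * y ^ 2 + q {-1}) * (Y - fps_const (x * y)))
          / (fps_const (y ^ 2) - fps_X ^ 2 * fps_const ((q {-1, 1} * y ^ 2 + q {-1}) ^ 2))"
    if "p {1} = 0" "p {-1, 1} > 0"
    unfolding D_def Y_def x_def y_def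
    using that by (intro D_plus_formula_no_up_step var2_nonzero) (simp_all add: q_def)
  note D_degree = D_plus_generic_degree[OF nonneg, folded q_def x_def y_def, folded D_def]
  note D1_degree = D_plus_at_1_degree[OF y1, of "\<lambda>s. const1 (p s)", folded D1_def]
  have D1_degree_2: "algebraic_degree D1 = 2" if "p {-1} > 0" "p {1} + p {-1, 1} > 0"
    using that by (intro D1_degree(3)) (simp_all flip: const1_add)
  note degrees = D_degree D1_degree(1,2) D1_degree_2 D_plus_0_0_degree[of p] D_plus_0_1_degree[OF nonneg]
  show ?thesis
    by (intro conjI impI degrees formula1 formula2 D_plus_0_1) simp_all
qed

end
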